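(* Let $L=\mathbb{Q}(\xi)$ be a totally real number field of degree $n$, where $\xi$ is a root of a monic irreducible polynomial $f(x)\in\mathbb{Z}[x]$ of degree $n$ all of whose roots are real. Let $(\ell_1=1,\ell_2,\ldots,\ell_n)$ be an integral basis of $L$, let $D_L$ be the discriminant of $L$, and let $I_L(x_2,\ldots,x_n)$ be the index form corresponding to this integral basis. Let $d>0$ be a square-free integer, let $M=\mathbb{Q}(i\sqrt d)$ with discriminant $D_M$, and assume $\gcd(D_L,D_M)=1$. Let $\omega=i\sqrt d$ if $-d\equiv 2,3 \pmod 4$ and $\omega=\frac{1+i\sqrt d}{2}$ if $-d\equiv 1\pmod 4$. Let $K=LM$ be the composite field, and let $$\alpha=x_1+x_2\ell_2+\cdots+x_n\ell_n+y_1\omega+y_2\omega\ell_2+\cdots+y_n\omega\ell_n$$ with $x_1,\ldots,x_n,y_1,\ldots,y_n\in\mathbb{Z}$. Assume that $\alpha$ generates a power integral basis in $K$. If $-d\equiv 2,3\pmod 4$, then $$|I_L(x_2,\ldots,x_n)|\le 1\quad\text{and}\quad |I_L(y_2,\ldots,y_n)|\le \frac{1}{(\sqrt d)^{n(n-1)/2}}.$$ If $-d\equiv 1\pmod 4$, then $$|I_L(2x_2+y_2,\ldots,2x_n+y_n)|\le 2^{n(n-1)/2}\quad\text{and}\quad |I_L(y_2,\ldots,y_n)|\le \left(\frac{2}{\sqrt d}\right)^{n(n-1)/2}.$$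
   Context: For a number field $F$ with ring of integers $\mathbb{Z}_F$, an element $\alpha\in\mathbb{Z}_F$ generates a power integral basis in $F$ if $\mathbb{Z}_F=\mathbb{Z}[\alpha]$, i.e. $(1,\alpha,\ldots,\alpha^{m-1})$ is an integral basis of $F$, where $m=[F:\mathbb{Q}]$. For $\gamma\in L$, denote by $\gamma^{(1)},\ldots,\gamma^{(n)}$ its conjugates, i.e. its images under the $n$ embeddings of $L$ into $\mathbb{R}$. The index form corresponding to the integral basis $(\ell_1=1,\ell_2,\ldots,\ell_n)$ of $L$ is $$I_L(x_2,\ldots,x_n)=\frac{1}{\sqrt{|D_L|}}\prod_{1\le j_1<j_2\le n}\left(x_2\left(\ell_2^{(j_1)}-\ell_2^{(j_2)}\right)+\cdots+x_n\left(\ell_n^{(j_1)}-\ell_n^{(j_2)}\right)\right),$$ which is a polynomial in $\mathbb{Z}[x_2,\ldots,x_n]$. Under the coprimality assumption $\gcd(D_L,D_M)=1$, $(1,\ell_2,\ldots,\ell_n,\omega,\omega\ell_2,\ldots,\omega\ell_n)$ is an integral basis of $K$, which has degree $2n$. *)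

theory Defs
  imports
    Complex_Main
    "HOL-Library.FuncSet"
    "HOL-Computational_Algebra.Computational_Algebra"
    "HOL-Number_Theory.Cong"
    "Jordan_Normal_Form.Determinant"
begin

text \<open>Number fields are represented by their carrier sets inside the complex numbers.\<close>

definition complex_subfield :: "complex set \<Rightarrow> bool" where
  "complex_subfield F \<longleftrightarrow> 0 \<in> F \<and> 1 \<in> F \<and>
     (\<forall>x\<in>F. \<forall>y\<in>F. x + y \<in> F \<and> x * y \<in> F) \<and>
     (\<forall>x\<in>F. - x \<in> F \<and> inverse x \<in> F)"

text \<open>Since the characteristic is 0, the subfield generated by a set \<open>S\<close> is \<open>\<rat>(S)\<close>; the composite
  of \<open>L\<close> and \<open>M\<close> is the subfield generated by \<open>L \<union> M\<close>.\<close>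

definition generated_field :: "complex set \<Rightarrow> complex set" where
  "generated_field S = \<Inter> {F. complex_subfield F \<and> S \<subseteq> F}"

definition ring_of_integers :: "complex set \<Rightarrow> complex set" where
  "ring_of_integers F = {x \<in> F. algebraic_int x}"

definition integral_basis :: "complex set \<Rightarrow> nat \<Rightarrow> (nat \<Rightarrow> complex) \<Rightarrow> bool" where
  "integral_basis F m b \<longleftrightarrow>
     ring_of_integers F = range (\<lambda>c :: nat \<Rightarrow> int. \<Sum>i=1..m. of_int (c i) * b i) \<and>
     (\<forall>c :: nat \<Rightarrow> int. (\<Sum>i=1..m. of_int (c i) * b i) = 0 \<longrightarrow> (\<forall>i\<in>{1..m}. c i = 0))"

definition int_adjoin :: "complex \<Rightarrow> complex set" where
  "int_adjoin \<alpha> = range (\<lambda>p :: int poly. poly (map_poly of_int p) \<alpha>)"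

definition generates_power_integral_basis :: "complex set \<Rightarrow> complex \<Rightarrow> bool" where
  "generates_power_integral_basis F \<alpha> \<longleftrightarrow>
     \<alpha> \<in> ring_of_integers F \<and> ring_of_integers F = int_adjoin \<alpha>"

text \<open>Embeddings of \<open>F\<close> into a field \<open>'a\<close> (used with real and complex targets). Extensionality makes
  an embedding determined by its values on \<open>F\<close>, so that embeddings can be counted.\<close>

definition field_embeddings :: "complex set \<Rightarrow> (complex \<Rightarrow> 'a :: field) set" where
  "field_embeddings F = {\<sigma> \<in> extensional F. \<sigma> 1 = 1 \<and>
     (\<forall>x\<in>F. \<forall>y\<in>F. \<sigma> (x + y) = \<sigma> x + \<sigma> y \<and> \<sigma> (x * y) = \<sigma> x * \<sigma> y)}"

text \<open>The discriminant of \<open>F\<close> is the integer \<open>det (\<sigma>\<^sub>i b\<^sub>j)\<^sup>2\<close>, where \<open>b\<^sub>1, \<dots>, b\<^sub>m\<close> is an integral basis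
  and \<open>\<sigma>\<^sub>1, \<dots>, \<sigma>\<^sub>m\<close> are the complex embeddings. For a number field it exists and does not depend on
  the basis or on the enumeration of the embeddings. Matrix indices start at 0, hence the shifts.\<close>

definition field_discriminant :: "complex set \<Rightarrow> int" where
  "field_discriminant F = (THE D. \<exists>m b \<sigma>. integral_basis F m b \<and>
     bij_betw \<sigma> {1..m} (field_embeddings F :: (complex \<Rightarrow> complex) set) \<and>
     of_int D = (det (mat m m (\<lambda>(i, j). \<sigma> (Suc i) (b (Suc j)))))\<^sup>2)"

text \<open>The index form of a totally real field \<open>F\<close> of degree \<open>n\<close>, for the integral basis
  \<open>b\<^sub>1 = 1, b\<^sub>2, \<dots>, b\<^sub>n\<close>, with \<open>\<sigma>\<^sub>1, \<dots>, \<sigma>\<^sub>n\<close> an enumeration of the real embeddings, so that the conjugate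
  \<open>\<gamma>\<^sup>(\<^sup>j\<^sup>)\<close> is \<open>\<sigma>\<^sub>j \<gamma>\<close>. The enumeration only affects the sign. Only the entries \<open>x\<^sub>2, \<dots>, x\<^sub>n\<close> of the
  argument are used.\<close>

definition index_form ::
  "complex set \<Rightarrow> nat \<Rightarrow> (nat \<Rightarrow> complex) \<Rightarrow> (nat \<Rightarrow> complex \<Rightarrow> real) \<Rightarrow> (nat \<Rightarrow> int) \<Rightarrow> real" where
  "index_form F n b \<sigma> x =
     1 / sqrt (of_int \<bar>field_discriminant F\<bar>) *
     (\<Prod>j=1..n. \<Prod>k\<in>{j<..n}. \<Sum>i=2..n. of_int (x i) * (\<sigma> j (b i) - \<sigma> k (b i)))"

definition imag_sqrt :: "int \<Rightarrow> complex" where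
  "imag_sqrt d = \<i> * complex_of_real (sqrt (of_int d))"

definition quadratic_omega :: "int \<Rightarrow> complex" where
  "quadratic_omega d =
     (if [- d = 1] (mod 4) then (1 + imag_sqrt d) / 2 else imag_sqrt d)"

end

theory Submission
  imports Defs "Jordan_Normal_Form.Char_Poly"
begin

text \<open>
  Write \<open>\<alpha> = A + \<omega> B\<close> with \<open>A = \<Sum> x\<^sub>i \<ell>\<^sub>i\<close> and \<open>B = \<Sum> y\<^sub>i \<ell>\<^sub>i\<close> in \<open>L\<close>, and let \<open>\<alpha>\<^sub>j = \<sigma>\<^sub>j A + \<omega> \<sigma>\<^sub>j B\<close> be its
  conjugates over \<open>M\<close>. The proof compares the relative discriminant of \<open>\<alpha>\<close> over \<open>M\<close> with that of the basis \<open>\<ell>\<close>.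

  If \<open>\<int>\<^sub>K = \<int>[\<alpha>]\<close>, then each \<open>\<ell>\<^sub>i\<close> is an integer polynomial in \<open>\<alpha>\<close>. Since \<open>\<alpha>\<close> acts on the free \<open>\<int>[\<omega>]\<close>-module
  spanned by the \<open>\<ell>\<^sub>i\<close>, it satisfies a monic equation of degree \<open>n\<close> over \<open>\<int>[\<omega>]\<close>, and so \<open>\<ell>\<^sub>i\<close> is
  already a \<open>\<int>[\<omega>]\<close>-combination of \<open>1, \<alpha>, \<dots>, \<alpha>\<^sup>n\<^sup>-\<^sup>1\<close>. Conversely these powers are \<open>\<int>[\<omega>]\<close>-combinations of the \<open>\<ell>\<^sub>i\<close>.
  The two transition matrices are inverse to each other (\<open>power_coordinates_unimodular\<close>), their
  determinants are units of an imaginary quadratic order, and such units have absolute value 1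
  (\<open>quadratic_order_unit_cmod\<close>). Conjugating gives (\<open>prod_conjugate_differences\<close>)
  \<open>\<Prod>\<^sub>j\<^sub><\<^sub>k \<bar>\<alpha>\<^sub>j - \<alpha>\<^sub>k\<bar> = \<bar>det (\<sigma>\<^sub>j \<ell>\<^sub>i)\<bar> = \<surd>\<bar>D\<^sub>L\<bar>\<close>; the last equality is \<open>field_discriminant_totally_real\<close>.

  Each factor is \<open>\<bar>\<alpha>\<^sub>j - \<alpha>\<^sub>k\<bar> = \<bar>X + \<omega> Y\<bar>\<close> with the real numbers \<open>X = \<sigma>\<^sub>j A - \<sigma>\<^sub>k A\<close> and \<open>Y = \<sigma>\<^sub>j B - \<sigma>\<^sub>k B\<close>, whose
  products over all pairs, divided by \<open>\<surd>\<bar>D\<^sub>L\<bar>\<close>, are the values of the index form at \<open>x\<close> and \<open>y\<close>. A complex number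
  is at least as large as its real part \<open>X + Re \<omega> \<cdot> Y\<close> and its imaginary part \<open>Im \<omega> \<cdot> Y\<close>. With
  \<open>\<omega> = i\<surd>d\<close> these are \<open>X\<close> and \<open>\<surd>d Y\<close>; with \<open>\<omega> = (1 + i\<surd>d)/2\<close> they are \<open>(2X + Y)/2\<close> and \<open>\<surd>d Y/2\<close>.
  Multiplying over the \<open>n (n - 1) / 2\<close> pairs yields all four bounds.
\<close>

section \<open>Determinants and Vandermonde products\<close>

lemma det_sum_product:
  fixes f g :: "nat \<Rightarrow> nat \<Rightarrow> 'a :: comm_ring_1"
  shows "det (mat n n (\<lambda>(i, j). \<Sum>k<n. f i k * g k j)) =
    det (mat n n (\<lambda>(i, j). f i j)) * det (mat n n (\<lambda>(i, j). g i j))"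
proof -
  have "mat n n (\<lambda>(i, j). \<Sum>k<n. f i k * g k j) =
      mat n n (\<lambda>(i, j). f i j) * mat n n (\<lambda>(i, j). g i j)"
    by (rule eq_matI) (auto simp: scalar_prod_def atLeast0LessThan)
  then show ?thesis
    by (simp add: det_mult[of _ n])
qed

lemma sum_of_bool_single:
  fixes f :: "nat \<Rightarrow> 'a :: semiring_1"
  shows "i < n \<Longrightarrow> (\<Sum>k<n. of_bool (i = k) * f k) = f i"
  by (subst sum.mono_neutral_right[of "{..<n}" "{i}"]) auto

lemma det_identity_entries: "det (mat n n (\<lambda>(i, j). of_bool (i = j) :: 'a :: comm_ring_1)) = 1"
proof -
  have "mat n n (\<lambda>(i, j). of_bool (i = j) :: 'a) = 1\<^sub>m n"
    by (rule eq_matI) auto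
  then show ?thesis by simp
qed

lemma det_swap_indices:
  "det (mat n n (\<lambda>(i, j). f j i)) = det (mat n n (\<lambda>(i, j). f i j :: 'a :: comm_ring_1))"
proof -
  have "mat n n (\<lambda>(i, j). f j i) = transpose_mat (mat n n (\<lambda>(i, j). f i j))"
    by (rule eq_matI) auto
  then show ?thesis by (simp add: det_transpose[of _ n])
qed

text \<open>
  The Newton basis \<open>1, x - a\<^sub>0, (x - a\<^sub>0)(x - a\<^sub>1), \<dots>\<close> is unitriangular over the monomials because each of
  its members is monic: multiplying by \<open>x\<close> gives \<open>x \<cdot> N\<^sub>k = N\<^sub>k\<^sub>+\<^sub>1 + a\<^sub>k N\<^sub>k\<close>. The expansion is stated for
  every sufficiently long range \<open>N\<close>, so that one set of coefficients serves matrices of any size.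
\<close>

lemma newton_expansion:
  fixes a :: "nat \<Rightarrow> 'a :: comm_ring_1"
  obtains c where "c m = 1" and "\<And>k. k > m \<Longrightarrow> c k = 0"
    and "\<And>x N. m < N \<Longrightarrow> x ^ m = (\<Sum>k<N. (\<Prod>i<k. x - a i) * c k)"
proof -
  have "\<exists>c. c m = 1 \<and> (\<forall>k>m. c k = 0) \<and>
      (\<forall>x N. m < N \<longrightarrow> x ^ m = (\<Sum>k<N. (\<Prod>i<k. x - a i) * c k))"
  proof (induction m)
    case 0
    have "(\<Sum>k<N. (\<Prod>i<k. x - a i) * (if k = 0 then 1 else 0)) = 1" if "0 < N" for N and x :: 'a
      using that by (subst sum.remove[of _ 0]) (auto intro!: sum.neutral)
    then show ?case by (intro exI[of _ "\<lambda>k. if k = 0 then 1 else 0"]) simp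
  next
    case (Suc m)
    then obtain c where c: "c m = 1" "\<And>k. k > m \<Longrightarrow> c k = 0"
      "\<And>x N. m < N \<Longrightarrow> x ^ m = (\<Sum>k<N. (\<Prod>i<k. x - a i) * c k)"
      by auto
    (* c' records x * N_k = N_{k+1} + a_k * N_k, where N_k is the k-th Newton polynomial. *)
    define c' where "c' k = (if k = 0 then 0 else c (k - 1)) + a k * c k" for k
    have "x ^ Suc m = (\<Sum>k<N. (\<Prod>i<k. x - a i) * c' k)" if N: "Suc m < N" for x N
    proof -
      obtain N' where N': "N = Suc N'" "m < N'" using N by (cases N) auto
      have "x ^ Suc m = (\<Sum>k<N'. x * ((\<Prod>i<k. x - a i) * c k))"
        using c(3)[OF N'(2)] by (simp add: sum_distrib_left)
      also have "\<dots> = (\<Sum>k<N'. (\<Prod>i<Suc k. x - a i) * c k) + (\<Sum>k<N'. (\<Prod>i<k. x - a i) * (a k * c k))"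
        unfolding sum.distrib[symmetric] by (intro sum.cong) (auto simp: algebra_simps)
      also have "(\<Sum>k<N'. (\<Prod>i<Suc k. x - a i) * c k) =
          (\<Sum>k<N. (\<Prod>i<k. x - a i) * (if k = 0 then 0 else c (k - 1)))"
        unfolding N' by (subst sum.lessThan_Suc_shift) simp
      also have "(\<Sum>k<N'. (\<Prod>i<k. x - a i) * (a k * c k)) = (\<Sum>k<N. (\<Prod>i<k. x - a i) * (a k * c k))"
        unfolding N' using c(2)[OF N'(2)] by simp
      finally show ?thesis
        unfolding sum.distrib[symmetric] c'_def by (simp add: distrib_left)
    qed
    moreover have "c' (Suc m) = 1" "\<forall>k>Suc m. c' k = 0"
      unfolding c'_def using c(1,2) by auto
    ultimately show ?case by blast
  qed
  then show ?thesis using that by blast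
qed

text \<open>
  In the Newton basis attached to the nodes themselves, the evaluation matrix is lower triangular with
  diagonal entries \<open>\<Prod>i<k. a k - a i\<close>, and the change to monomials is unitriangular.
\<close>

lemma det_vandermonde:
  fixes a :: "nat \<Rightarrow> 'a :: comm_ring_1"
  shows "det (mat n n (\<lambda>(j, m). a j ^ m)) = (\<Prod>k<n. \<Prod>i<k. a k - a i)"
proof -
  have "\<forall>m. \<exists>c. c m = 1 \<and> (\<forall>k>m. c k = 0) \<and>
      (\<forall>x N. m < N \<longrightarrow> x ^ m = (\<Sum>k<N. (\<Prod>i<k. x - a i) * c k))"
    by (metis newton_expansion)
  then obtain c where c: "\<And>m. c m m = 1" "\<And>m k. k > m \<Longrightarrow> c m k = 0"
      "\<And>x N m. m < N \<Longrightarrow> x ^ m = (\<Sum>k<N. (\<Prod>i<k. x - a i) * c m k)"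
    by metis
  have "mat n n (\<lambda>(j, m). a j ^ m) = mat n n (\<lambda>(j, m). \<Sum>k<n. (\<Prod>i<k. a j - a i) * c m k)"
    by (rule eq_matI) (use c(3) in auto)
  moreover have "det (mat n n (\<lambda>(j, k). \<Prod>i<k. a j - a i)) = (\<Prod>k<n. \<Prod>i<k. a k - a i)"
  proof (subst det_lower_triangular[of n])
    show "mat n n (\<lambda>(j, k). \<Prod>i<k. a j - a i) $$ (i, j) = 0" if "i < j" "j < n" for i j
      using that by (auto intro!: prod_zero bexI[of _ i])
    have "diag_mat (mat n n (\<lambda>(j, k). \<Prod>i<k. a j - a i)) = map (\<lambda>k. \<Prod>i<k. a k - a i) [0..<n]"
      by (simp add: diag_mat_def)
    then show "prod_list (diag_mat (mat n n (\<lambda>(j, k). \<Prod>i<k. a j - a i))) = (\<Prod>k<n. \<Prod>i<k. a k - a i)"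
      using prod.distinct_set_conv_list[of "[0..<n]" "\<lambda>k. \<Prod>i<k. a k - a i"]
      by (simp add: atLeast0LessThan)
  qed simp
  moreover have "det (mat n n (\<lambda>(k, m). c m k)) = 1"
    by (subst det_upper_triangular[of _ n]) (auto simp: c diag_mat_def upper_triangular_def intro!: prod_list_neutral)
  ultimately show ?thesis
    by (simp add: det_sum_product[of n "\<lambda>j k. \<Prod>i<k. a j - a i" "\<lambda>k m. c m k"])
qed

section \<open>Generators of modules over a subring\<close>

text \<open>
  A carrier-set notion of subring inside a type class ring: it lets the same closure argument for
  determinants serve a ring of numbers and, through \<open>polynomials\<close>, the ring of polynomials over it.
\<close>

locale unital_subring =
  fixes R :: "'a :: comm_ring_1 set"
  assumes one: "1 \<in> R"
    and diff: "x \<in> R \<Longrightarrow> y \<in> R \<Longrightarrow> x - y \<in> R"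
    and mult: "x \<in> R \<Longrightarrow> y \<in> R \<Longrightarrow> x * y \<in> R"
begin

lemma zero: "0 \<in> R" using diff[OF one one] by simp

lemma uminus: "x \<in> R \<Longrightarrow> - x \<in> R" using diff[OF zero] by simp

lemma add: "x \<in> R \<Longrightarrow> y \<in> R \<Longrightarrow> x + y \<in> R" using diff[OF _ uminus] by simp

lemma sum: "(\<And>i. i \<in> A \<Longrightarrow> f i \<in> R) \<Longrightarrow> (\<Sum>i\<in>A. f i) \<in> R"
  by (induction A rule: infinite_finite_induct) (auto intro: zero add)

lemma prod: "(\<And>i. i \<in> A \<Longrightarrow> f i \<in> R) \<Longrightarrow> (\<Prod>i\<in>A. f i) \<in> R"
  by (induction A rule: infinite_finite_induct) (auto intro: one mult)

lemma of_int: "of_int k \<in> R"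
  by (induction k rule: int_induct[where k = 0]) (auto intro: zero add diff one)

lemma det: "(\<And>i j. i < n \<Longrightarrow> j < n \<Longrightarrow> f i j \<in> R) \<Longrightarrow> det (mat n n (\<lambda>(i, j). f i j)) \<in> R"
proof -
  assume f: "\<And>i j. i < n \<Longrightarrow> j < n \<Longrightarrow> f i j \<in> R"
  have perm: "p i < n" if "p permutes {0..<n}" "i < n" for p i
    using permutes_in_image[OF that(1), of i] that(2) by simp
  show ?thesis
    by (subst det_def'[of _ n])
      (auto intro!: sum mult prod of_int f simp: perm)
qed

lemma polynomials: "unital_subring {p. \<forall>i. coeff p i \<in> R}"
proof
  show "1 \<in> {p. \<forall>i. coeff p i \<in> R}"
    by (auto simp: coeff_1 one zero)
  show "p - q \<in> {p. \<forall>i. coeff p i \<in> R}" if "p \<in> {p. \<forall>i. coeff p i \<in> R}" "q \<in> {p. \<forall>i. coeff p i \<in> R}" for p q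
    using that by (auto intro: diff)
  show "p * q \<in> {p. \<forall>i. coeff p i \<in> R}" if "p \<in> {p. \<forall>i. coeff p i \<in> R}" "q \<in> {p. \<forall>i. coeff p i \<in> R}" for p q
    using that by (auto simp: coeff_mult intro!: sum mult)
qed

end

lemma (in unital_subring) char_poly_coeff:
  assumes "\<And>i j. i < n \<Longrightarrow> j < n \<Longrightarrow> f i j \<in> R"
  shows "coeff (char_poly (mat n n (\<lambda>(i, j). f i j))) m \<in> R"
proof -
  interpret P: unital_subring "{p. \<forall>i. coeff p i \<in> R}" by (rule polynomials)
  have "char_poly_matrix (mat n n (\<lambda>(i, j). f i j)) =
      mat n n (\<lambda>(i, j). (if i = j then [:0, 1:] else 0) + [:- f i j:])"
    unfolding char_poly_matrix_def by (rule eq_matI) auto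
  moreover have "det (mat n n (\<lambda>(i, j). (if i = j then [:0, 1:] else 0) + [:- f i j:])) \<in> {p. \<forall>i. coeff p i \<in> R}"
    by (intro P.det) (auto simp: coeff_pCons split: nat.splits intro!: assms uminus add zero one)
  ultimately show ?thesis by (simp add: char_poly_def)
qed

text \<open>
  An element acting on a finitely generated \<open>R\<close>-module through a matrix over \<open>R\<close> is an eigenvalue of that
  matrix, hence a root of its characteristic polynomial, which is monic with coefficients in \<open>R\<close>.
\<close>

lemma monic_relation_of_eigenvector:
  fixes \<alpha> :: "'a :: field"
  assumes R: "unital_subring R" and f: "\<And>i j. i < n \<Longrightarrow> j < n \<Longrightarrow> f i j \<in> R"
    and eig: "\<And>i. i < n \<Longrightarrow> \<alpha> * b i = (\<Sum>j<n. f i j * b j)"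
    and nz: "k < n" "b k \<noteq> 0"
  obtains g where "\<And>m. g m \<in> R" and "\<alpha> ^ n = (\<Sum>m<n. g m * \<alpha> ^ m)"
proof -
  interpret unital_subring R by (rule R)
  define A where "A = mat n n (\<lambda>(i, j). f i j)"
  have A: "A \<in> carrier_mat n n" by (simp add: A_def)
  have "eigenvector A (vec n b) \<alpha>"
    unfolding eigenvector_def
  proof (intro conjI)
    show "vec n b \<noteq> 0\<^sub>v (dim_row A)"
      using nz A by (auto simp: vec_eq_iff)
    show "A *\<^sub>v vec n b = \<alpha> \<cdot>\<^sub>v vec n b"
      by (rule eq_vecI) (auto simp: A_def scalar_prod_def eig atLeast0LessThan)
  qed (use A in auto)
  then have root: "poly (char_poly A) \<alpha> = 0"
    using eigenvalue_root_char_poly[OF A] unfolding eigenvalue_def by blast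
  have deg: "degree (char_poly A) = n" "coeff (char_poly A) n = 1"
    using degree_monic_char_poly[OF A] by auto
  show ?thesis
  proof (rule that[of "\<lambda>m. - coeff (char_poly A) m"])
    show "- coeff (char_poly A) m \<in> R" for m
      unfolding A_def by (intro uminus char_poly_coeff f)
    have "0 = (\<Sum>m<n. coeff (char_poly A) m * \<alpha> ^ m) + \<alpha> ^ n"
      using root unfolding poly_altdef deg(1) by (simp add: lessThan_Suc_atMost[symmetric] deg)
    then show "\<alpha> ^ n = (\<Sum>m<n. - coeff (char_poly A) m * \<alpha> ^ m)"
      by (simp add: sum_negf eq_neg_iff_add_eq_0 add.commute)
  qed
qed

lemma reduce_polynomial_value:
  fixes \<alpha> :: "'a :: comm_ring_1"
  assumes R: "unital_subring R" and "0 < n" and g: "\<And>m. g m \<in> R"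
    and rel: "\<alpha> ^ n = (\<Sum>m<n. g m * \<alpha> ^ m)"
    and p: "\<And>m. coeff p m \<in> R"
  obtains r where "\<And>m. r m \<in> R" and "poly p \<alpha> = (\<Sum>m<n. r m * \<alpha> ^ m)"
proof -
  interpret unital_subring R by (rule R)
  obtain n' where n': "n = Suc n'" using \<open>0 < n\<close> by (cases n) auto
  have "\<exists>r. (\<forall>m. r m \<in> R) \<and> poly p \<alpha> = (\<Sum>m<n. r m * \<alpha> ^ m)"
    using p
  proof (induction p)
    case 0
    then show ?case by (intro exI[of _ "\<lambda>_. 0"]) (simp add: zero)
  next
    case (pCons c q)
    have "coeff q m \<in> R" for m using pCons.prems[of "Suc m"] by simp
    then obtain r where r: "\<And>m. r m \<in> R" "poly q \<alpha> = (\<Sum>m<n. r m * \<alpha> ^ m)"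
      using pCons.IH by blast
    (* Multiplication by \<alpha> shifts the coefficients; the overflowing top term is replaced by the relation. *)
    define r' where "r' m = (if m = 0 then c else r (m - 1)) + r n' * g m" for m
    have "poly (pCons c q) \<alpha> = c + (\<Sum>m<n. r m * \<alpha> ^ Suc m)"
      by (simp add: r(2) sum_distrib_left mult.left_commute)
    also have "(\<Sum>m<n. r m * \<alpha> ^ Suc m) = (\<Sum>m<n'. r m * \<alpha> ^ Suc m) + r n' * \<alpha> ^ n"
      unfolding n' by simp
    also have "c + ((\<Sum>m<n'. r m * \<alpha> ^ Suc m) + r n' * \<alpha> ^ n) =
        (\<Sum>m<n. (if m = 0 then c else r (m - 1)) * \<alpha> ^ m) + r n' * \<alpha> ^ n"
      unfolding n' sum.lessThan_Suc_shift[of "\<lambda>m. (if m = 0 then c else r (m - 1)) * \<alpha> ^ m" n']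
      by (simp add: add.assoc)
    also have "\<dots> = (\<Sum>m<n. r' m * \<alpha> ^ m)"
      unfolding rel r'_def by (simp add: sum_distrib_left sum.distrib algebra_simps)
    finally have "poly (pCons c q) \<alpha> = (\<Sum>m<n. r' m * \<alpha> ^ m)" .
    moreover have "r' m \<in> R" for m
      unfolding r'_def using pCons.prems[of 0] by (auto intro!: add mult r g)
    ultimately show ?case by blast
  qed
  then show ?thesis using that by blast
qed

text \<open>
  If \<open>b\<close> spans an \<open>R\<close>-algebra freely and the algebra is generated over \<open>R\<close> by \<open>\<alpha> = \<Sum> z\<^sub>i b\<^sub>i\<close>, then
  \<open>1, \<alpha>, \<dots>, \<alpha>\<^sup>n\<^sup>-\<^sup>1\<close> is another basis: the monic relation of degree \<open>n\<close> for \<open>\<alpha>\<close> reduces every \<open>b\<^sub>i\<close> to a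
  combination of these powers, so the coordinate matrix \<open>E\<close> of the powers has an inverse over \<open>R\<close>.

  The coordinates \<open>E\<close> are computed from the multiplication table \<open>c\<close> and from \<open>z\<close> alone. They are therefore
  valid for every solution \<open>s\<close> of the table, in particular for every conjugate of the basis \<open>b\<close>; no
  extension of the embeddings to the larger field has to be constructed.
\<close>

lemma power_coordinates_unimodular:
  fixes b :: "nat \<Rightarrow> 'a :: field"
  assumes R: "unital_subring R" and n: "0 < n"
    and c: "\<And>i k m. c i k m \<in> R"
    and table: "\<And>i k. i < n \<Longrightarrow> k < n \<Longrightarrow> b i * b k = (\<Sum>m<n. c i k m * b m)"
    and b0: "b 0 = 1"
    and indep: "\<And>e. (\<And>i. e i \<in> R) \<Longrightarrow> (\<Sum>i<n. e i * b i) = 0 \<Longrightarrow> \<forall>i<n. e i = 0"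
    and z: "\<And>i. z i \<in> R"
    and gen: "\<And>i. i < n \<Longrightarrow> \<exists>p. (\<forall>m. coeff p m \<in> R) \<and> b i = poly p (\<Sum>i<n. z i * b i)"
  obtains E u where
    "\<And>s m. s 0 = 1 \<Longrightarrow> (\<And>i k. i < n \<Longrightarrow> k < n \<Longrightarrow> s i * s k = (\<Sum>m<n. c i k m * s m)) \<Longrightarrow>
       (\<Sum>i<n. z i * s i) ^ m = (\<Sum>i<n. E m i * s i)"
    and "u \<in> R" and "det (mat n n (\<lambda>(m, i). E m i)) \<in> R"
    and "u * det (mat n n (\<lambda>(m, i). E m i)) = 1"
proof -
  interpret unital_subring R by (rule R)
  (* A is the matrix of multiplication by the sum of the z q * b q; E m holds the coordinates of the m-th power,
     starting from the unit vector of b 0 = 1. *)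
  define A where "A i k = (\<Sum>q<n. z q * c q i k)" for i k
  have A_in: "A i k \<in> R" for i k
    unfolding A_def by (intro sum mult z c)
  define E where "E = rec_nat (\<lambda>k. if k = 0 then 1 else 0) (\<lambda>_ e k. \<Sum>i<n. e i * A i k)"
  have E0: "E 0 k = (if k = 0 then 1 else 0)" for k by (simp add: E_def)
  have ESuc: "E (Suc m) k = (\<Sum>i<n. E m i * A i k)" for m k by (simp add: E_def)
  have E_in: "E m k \<in> R" for m k
    by (induction m arbitrary: k) (auto simp: E0 ESuc one zero intro!: sum mult A_in)
  have eig: "(\<Sum>q<n. z q * s q) * s i = (\<Sum>k<n. A i k * s k)"
    if s: "\<And>i k. i < n \<Longrightarrow> k < n \<Longrightarrow> s i * s k = (\<Sum>m<n. c i k m * s m)" and i: "i < n" for s i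
  proof -
    have "(\<Sum>q<n. z q * s q) * s i = (\<Sum>q<n. \<Sum>k<n. z q * c q i k * s k)"
      unfolding sum_distrib_right using i by (intro sum.cong) (auto simp: s sum_distrib_left mult.assoc)
    also have "\<dots> = (\<Sum>k<n. A i k * s k)"
      unfolding A_def sum_distrib_right by (rule sum.swap)
    finally show ?thesis .
  qed
  have pow: "(\<Sum>i<n. z i * s i) ^ m = (\<Sum>i<n. E m i * s i)"
    if s0: "s 0 = 1" and s: "\<And>i k. i < n \<Longrightarrow> k < n \<Longrightarrow> s i * s k = (\<Sum>m<n. c i k m * s m)" for s m
  proof (induction m)
    case 0
    have "(\<Sum>i<n. E 0 i * s i) = E 0 0 * s 0"
      using n by (subst sum.remove[of _ 0]) (auto simp: E0 intro!: sum.neutral)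
    then show ?case by (simp add: s0 E0)
  next
    case (Suc m)
    have "(\<Sum>i<n. z i * s i) ^ Suc m = (\<Sum>i<n. \<Sum>k<n. E m i * (A i k * s k))"
      unfolding power_Suc Suc sum_distrib_left
      by (intro sum.cong refl, subst mult.left_commute) (simp add: eig[OF s] flip: sum_distrib_left)
    also have "\<dots> = (\<Sum>k<n. E (Suc m) k * s k)"
      unfolding ESuc sum_distrib_right by (subst sum.swap) (simp add: mult.assoc)
    finally show ?case .
  qed
  define \<alpha> where "\<alpha> = (\<Sum>i<n. z i * b i)"
  have "\<alpha> * b i = (\<Sum>j<n. A i j * b j)" if "i < n" for i
    unfolding \<alpha>_def by (rule eig[OF table that])
  moreover have "b 0 \<noteq> 0" by (simp add: b0)
  ultimately obtain g where g: "\<And>m. g m \<in> R" "\<alpha> ^ n = (\<Sum>m<n. g m * \<alpha> ^ m)"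
    using monic_relation_of_eigenvector[OF R, where n = n and f = A and \<alpha> = \<alpha> and b = b and k = 0] A_in n
    by blast
  have "\<exists>r. (\<forall>m. r m \<in> R) \<and> b i = (\<Sum>m<n. r m * \<alpha> ^ m)" if i: "i < n" for i
  proof -
    obtain p where p: "\<And>m. coeff p m \<in> R" "b i = poly p \<alpha>"
      using gen[OF i] unfolding \<alpha>_def by blast
    obtain r where "\<And>m. r m \<in> R" "poly p \<alpha> = (\<Sum>m<n. r m * \<alpha> ^ m)"
      using reduce_polynomial_value[OF R n g p(1)] by blast
    then show ?thesis using p(2) by auto
  qed
  then have "\<forall>i. \<exists>r. i < n \<longrightarrow> (\<forall>m. r m \<in> R) \<and> b i = (\<Sum>m<n. r m * \<alpha> ^ m)"
    by blast
  from choice[OF this] obtain r where r: "\<And>i m. i < n \<Longrightarrow> r i m \<in> R"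
      "\<And>i. i < n \<Longrightarrow> b i = (\<Sum>m<n. r i m * \<alpha> ^ m)"
    by blast
  have inverse: "(\<Sum>m<n. r i m * E m k) = of_bool (i = k)" if i: "i < n" and k: "k < n" for i k
  proof -
    define e where "e k = (\<Sum>m<n. r i m * E m k) - of_bool (i = k)" for k
    have "(\<Sum>k<n. e k * b k) = (\<Sum>k<n. \<Sum>m<n. r i m * (E m k * b k)) - (\<Sum>k<n. of_bool (i = k) * b k)"
      unfolding e_def by (simp add: left_diff_distrib sum_subtractf sum_distrib_right mult.assoc)
    also have "(\<Sum>k<n. \<Sum>m<n. r i m * (E m k * b k)) = (\<Sum>m<n. r i m * \<alpha> ^ m)"
      by (subst sum.swap) (simp add: \<alpha>_def pow[OF b0 table] sum_distrib_left)
    also have "(\<Sum>k<n. of_bool (i = k) * b k) = b i"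
      by (rule sum_of_bool_single[OF i])
    finally have "(\<Sum>k<n. e k * b k) = 0" using r(2)[OF i] by simp
    moreover have "e k \<in> R" for k
    proof -
      have "of_bool (i = k) \<in> R" using one zero by simp
      then show ?thesis unfolding e_def by (intro diff sum mult r(1)[OF i] E_in)
    qed
    ultimately have "e k = 0" using indep[of e] k by blast
    then show ?thesis unfolding e_def by simp
  qed
  have "det (mat n n (\<lambda>(i, k). \<Sum>m<n. r i m * E m k)) = 1"
  proof -
    have "mat n n (\<lambda>(i, k). \<Sum>m<n. r i m * E m k) = mat n n (\<lambda>(i, j). of_bool (i = j))"
      by (rule eq_matI) (auto simp: inverse)
    then show ?thesis by (simp add: det_identity_entries)
  qed
  then have "det (mat n n (\<lambda>(i, m). r i m)) * det (mat n n (\<lambda>(m, i). E m i)) = 1"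
    by (simp add: det_sum_product)
  moreover have "det (mat n n (\<lambda>(i, m). r i m)) \<in> R" "det (mat n n (\<lambda>(m, i). E m i)) \<in> R"
    by (intro det; simp add: r E_in)+
  ultimately show ?thesis using that[of E] pow by blast
qed

section \<open>Subfields of the complex numbers and their embeddings\<close>

lemma generated_field_superset: "S \<subseteq> generated_field S"
  by (auto simp: generated_field_def)

lemma generated_field_minimal: "complex_subfield F \<Longrightarrow> S \<subseteq> F \<Longrightarrow> generated_field S \<subseteq> F"
  by (auto simp: generated_field_def)

lemma complex_subfield_generated_field: "complex_subfield (generated_field S)"
  unfolding complex_subfield_def generated_field_def by blast

lemma complex_subfield_of_int: "complex_subfield F \<Longrightarrow> of_int k \<in> F"
proof -
  assume F: "complex_subfield F"
  interpret unital_subring F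
    by standard (use F in \<open>auto simp: complex_subfield_def diff_conv_add_uminus simp del: add_uminus_conv_diff\<close>)
  show ?thesis by (rule of_int)
qed

lemma complex_subfield_sum:
  "complex_subfield F \<Longrightarrow> (\<And>i. i \<in> A \<Longrightarrow> f i \<in> F) \<Longrightarrow> (\<Sum>i\<in>A. f i) \<in> F"
  by (induction A rule: infinite_finite_induct) (auto simp: complex_subfield_def)

lemma complex_subfield_Reals: "complex_subfield \<real>"
  by (auto simp: complex_subfield_def)

context
  fixes F :: "complex set" and \<tau> :: "complex \<Rightarrow> 'a :: field"
  assumes F: "complex_subfield F" and \<tau>: "\<tau> \<in> field_embeddings F"
begin

lemma embedding_one: "\<tau> 1 = 1"
  using \<tau> by (simp add: field_embeddings_def)

lemma embedding_add: "x \<in> F \<Longrightarrow> y \<in> F \<Longrightarrow> \<tau> (x + y) = \<tau> x + \<tau> y"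
  using \<tau> by (simp add: field_embeddings_def)

lemma embedding_mult: "x \<in> F \<Longrightarrow> y \<in> F \<Longrightarrow> \<tau> (x * y) = \<tau> x * \<tau> y"
  using \<tau> by (simp add: field_embeddings_def)

lemma embedding_zero: "\<tau> 0 = 0"
proof -
  have "0 \<in> F" using F by (simp add: complex_subfield_def)
  then have "\<tau> 0 + \<tau> 0 = \<tau> 0 + 0" using embedding_add[of 0 0] by simp
  then show ?thesis by (rule add_left_imp_eq)
qed

lemma embedding_minus: "x \<in> F \<Longrightarrow> \<tau> (- x) = - \<tau> x"
  using embedding_add[of x "- x"] F embedding_zero
  by (simp add: complex_subfield_def eq_neg_iff_add_eq_0 add.commute)

lemma embedding_of_int: "\<tau> (of_int k) = of_int k"
proof (induction k rule: int_induct[where k = 0])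
  case base
  show ?case by (simp add: embedding_zero)
next
  case (step1 i)
  then show ?case
    using embedding_add[of "of_int i" 1] complex_subfield_of_int[OF F] F embedding_one
    by (simp add: complex_subfield_def)
next
  case (step2 i)
  then show ?case
    using embedding_add[of "of_int i" "- 1"] complex_subfield_of_int[OF F, of "-1"]
      complex_subfield_of_int[OF F, of i] F embedding_one embedding_minus[of 1]
    by (simp add: complex_subfield_def)
qed

lemma embedding_sum:
  "(\<And>i. i \<in> A \<Longrightarrow> f i \<in> F) \<Longrightarrow> \<tau> (\<Sum>i\<in>A. f i) = (\<Sum>i\<in>A. \<tau> (f i))"
proof (induction A rule: infinite_finite_induct)
  case (insert a A)
  then show ?case
    by (simp add: embedding_add complex_subfield_sum[OF F])
qed (simp_all add: embedding_zero)

lemma embedding_int_combination: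
  assumes "\<And>i. i < n \<Longrightarrow> b i \<in> F"
  shows "\<tau> (\<Sum>i<n. of_int (c i) * b i) = (\<Sum>i<n. of_int (c i) * \<tau> (b i))"
proof -
  have "of_int (c i) * b i \<in> F" if "i < n" for i
    using F assms[OF that] complex_subfield_of_int[OF F] by (simp add: complex_subfield_def)
  then have "\<tau> (\<Sum>i<n. of_int (c i) * b i) = (\<Sum>i<n. \<tau> (of_int (c i) * b i))"
    by (intro embedding_sum) simp
  then show ?thesis
    by (simp add: embedding_mult embedding_of_int assms complex_subfield_of_int[OF F])
qed

end

section \<open>The discriminant as the square of a determinant of conjugates\<close>

lemma integral_basis_span:
  assumes "integral_basis F n b"
  shows "u \<in> ring_of_integers F \<longleftrightarrow> (\<exists>c. u = (\<Sum>i<n. of_int (c i) * b (Suc i)))"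
proof
  assume "u \<in> ring_of_integers F"
  then obtain c :: "nat \<Rightarrow> int" where "u = (\<Sum>i=1..n. of_int (c i) * b i)"
    using assms by (auto simp: integral_basis_def)
  then show "\<exists>c. u = (\<Sum>i<n. of_int (c i) * b (Suc i))"
    by (intro exI[of _ "\<lambda>i. c (Suc i)"]) (simp add: sum.atLeast1_atMost_eq)
next
  assume "\<exists>c. u = (\<Sum>i<n. of_int (c i) * b (Suc i))"
  then obtain c where "u = (\<Sum>i<n. of_int (c i) * b (Suc i))" ..
  then have "u = (\<Sum>i=1..n. of_int ((\<lambda>i. c (i - 1)) i) * b i)"
    by (simp add: sum.atLeast1_atMost_eq)
  then show "u \<in> ring_of_integers F"
    using assms unfolding integral_basis_def by (simp only:) (rule rangeI)
qed

lemma integral_basis_indep: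
  assumes "integral_basis F n b" and "(\<Sum>i<n. of_int (c i) * b (Suc i)) = 0" and "i < n"
  shows "c i = 0"
proof -
  have "(\<Sum>i=1..n. of_int ((\<lambda>i. c (i - 1)) i) * b i) = 0"
    using assms(2) by (simp add: sum.atLeast1_atMost_eq)
  then have "\<forall>i\<in>{1..n}. c (i - 1) = 0"
    using assms(1) unfolding integral_basis_def by (elim conjE allE) (erule mp)
  from this[rule_format, of "Suc i"] show ?thesis using assms(3) by simp
qed

lemma integral_basis_mem:
  assumes "integral_basis F n b" and "i < n"
  shows "b (Suc i) \<in> ring_of_integers F"
proof -
  have "b (Suc i) = (\<Sum>k<n. of_int (of_bool (i = k)) * b (Suc k))"
    unfolding of_int_of_bool
    by (rule sum_of_bool_single[OF assms(2), of "\<lambda>k. b (Suc k)", symmetric])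
  then have "\<exists>c. b (Suc i) = (\<Sum>k<n. of_int (c k) * b (Suc k))"
    by (intro exI[of _ "\<lambda>k. of_bool (i = k)"])
  then show ?thesis by (rule integral_basis_span[OF assms(1), THEN iffD2])
qed

lemma integral_basis_in_field:
  "integral_basis F n b \<Longrightarrow> i < n \<Longrightarrow> b (Suc i) \<in> F"
  using integral_basis_mem by (auto simp: ring_of_integers_def)

text \<open>
  The rows of the invertible matrix \<open>W\<close> are eigenvectors of \<open>M\<close> with eigenvalues \<open>t\<close>. For the multiplication
  matrix \<open>M\<close> of an algebraic integer this makes the sum of its conjugates an integer.
\<close>

lemma sum_eigenvalues_eq_trace:
  fixes W :: "nat \<Rightarrow> nat \<Rightarrow> 'a :: field"
  assumes det: "det (mat n n (\<lambda>(j, i). W j i)) \<noteq> 0"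
    and eig: "\<And>j i. j < n \<Longrightarrow> i < n \<Longrightarrow> t j * W j i = (\<Sum>k<n. M i k * W j k)"
  shows "(\<Sum>j<n. t j) = (\<Sum>i<n. M i i)"
proof -
  define A where "A = mat n n (\<lambda>(j, i). W j i)"
  have A: "A \<in> carrier_mat n n" by (simp add: A_def)
  note adj = adj_mat[OF A]
  define V where "V i j = adj_mat A $$ (i, j)" for i j
  (* The adjugate V serves as an inverse up to the factor det A, which cancels at the end. *)
  have right: "(\<Sum>i<n. W j i * V i j) = det A" if "j < n" for j
  proof -
    have "(A * adj_mat A) $$ (j, j) = (\<Sum>i<n. W j i * V i j)"
      using that adj(1) by (auto simp: A_def V_def scalar_prod_def atLeast0LessThan)
    then show ?thesis using adj(2) that by simp
  qed
  have left: "(\<Sum>j<n. V i j * W j k) = (of_bool (i = k) * det A)" if "i < n" "k < n" for i k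
  proof -
    have "(adj_mat A * A) $$ (i, k) = (\<Sum>j<n. V i j * W j k)"
      using that adj(1) by (auto simp: A_def V_def scalar_prod_def atLeast0LessThan)
    from this[symmetric] show ?thesis unfolding adj(3) using that by simp
  qed
  have "det A * (\<Sum>j<n. t j) = (\<Sum>j<n. \<Sum>i<n. t j * W j i * V i j)"
    unfolding sum_distrib_left
    by (intro sum.cong) (auto simp: right[symmetric] sum_distrib_right sum_distrib_left algebra_simps)
  also have "\<dots> = (\<Sum>j<n. \<Sum>i<n. \<Sum>k<n. M i k * (V i j * W j k))"
    by (intro sum.cong refl) (simp add: eig sum_distrib_right, simp add: mult_ac)
  also have "\<dots> = (\<Sum>i<n. \<Sum>j<n. \<Sum>k<n. M i k * (V i j * W j k))"
    by (rule sum.swap)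
  also have "\<dots> = (\<Sum>i<n. \<Sum>k<n. M i k * (\<Sum>j<n. V i j * W j k))"
    unfolding sum_distrib_left by (intro sum.cong refl sum.swap)
  also have "\<dots> = (\<Sum>i<n. M i i * det A)"
  proof (intro sum.cong refl)
    fix i assume i: "i \<in> {..<n}"
    have "(\<Sum>k<n. M i k * (\<Sum>j<n. V i j * W j k)) = (\<Sum>k<n. of_bool (i = k) * (M i k * det A))"
      using i by (intro sum.cong) (auto simp: left)
    also have "\<dots> = M i i * det A"
      by (rule sum_of_bool_single) (use i in simp)
    finally show "(\<Sum>k<n. M i k * (\<Sum>j<n. V i j * W j k)) = M i i * det A" .
  qed
  finally have "det A * (\<Sum>j<n. t j) = det A * (\<Sum>i<n. M i i)"
    by (simp add: sum_distrib_left mult.commute)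
  then show ?thesis using det by (simp add: A_def)
qed

text \<open>
  The transpose of the matrix of conjugates times the matrix itself has the traces of \<open>b\<^sub>i b\<^sub>k\<close> as entries. These are
  sums over all embeddings, so the enumeration \<open>\<sigma>\<close> disappears.
\<close>

lemma det_embeddings_square:
  fixes \<sigma> :: "nat \<Rightarrow> complex \<Rightarrow> 'a :: field"
  assumes F: "complex_subfield F"
    and \<sigma>: "bij_betw \<sigma> {1..n} (field_embeddings F)"
    and b: "\<And>i. i < n \<Longrightarrow> b (Suc i) \<in> F"
  shows "(det (mat n n (\<lambda>(j, i). \<sigma> (Suc j) (b (Suc i)))))\<^sup>2 =
    det (mat n n (\<lambda>(i, k). \<Sum>\<tau>\<in>field_embeddings F. \<tau> (b (Suc i) * b (Suc k))))"
proof -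
  have \<sigma>_in: "\<sigma> (Suc j) \<in> field_embeddings F" if "j < n" for j
    using that bij_betw_apply[OF \<sigma>, of "Suc j"] by simp
  have "(\<Sum>j<n. \<sigma> (Suc j) (b (Suc i)) * \<sigma> (Suc j) (b (Suc k))) =
      (\<Sum>\<tau>\<in>field_embeddings F. \<tau> (b (Suc i) * b (Suc k)))" if "i < n" "k < n" for i k
  proof -
    have "(\<Sum>j<n. \<sigma> (Suc j) (b (Suc i)) * \<sigma> (Suc j) (b (Suc k))) =
        (\<Sum>j<n. \<sigma> (Suc j) (b (Suc i) * b (Suc k)))"
      by (intro sum.cong) (auto simp: embedding_mult[OF F \<sigma>_in] b that)
    also have "\<dots> = (\<Sum>j=1..n. \<sigma> j (b (Suc i) * b (Suc k)))"
      by (simp add: sum.atLeast1_atMost_eq)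
    also have "\<dots> = (\<Sum>\<tau>\<in>field_embeddings F. \<tau> (b (Suc i) * b (Suc k)))"
      by (rule sum.reindex_bij_betw[OF \<sigma>])
    finally show ?thesis .
  qed
  then have "mat n n (\<lambda>(i, k). \<Sum>\<tau>\<in>field_embeddings F. \<tau> (b (Suc i) * b (Suc k))) =
      mat n n (\<lambda>(i, k). \<Sum>j<n. \<sigma> (Suc j) (b (Suc i)) * \<sigma> (Suc j) (b (Suc k)))"
    by (intro eq_matI) auto
  then show ?thesis
    by (simp add: det_sum_product[of n "\<lambda>i j. \<sigma> (Suc j) (b (Suc i))"]
        det_swap_indices[of n "\<lambda>j i. \<sigma> (Suc j) (b (Suc i))"] power2_eq_square)
qed

text \<open>
  Two integral bases differ by integer matrices that are inverse to each other, hence of determinant \<open>\<plusminus>1\<close>.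
\<close>

lemma det_embeddings_square_basis_independent:
  fixes \<sigma> \<sigma>' :: "nat \<Rightarrow> complex \<Rightarrow> complex"
  assumes F: "complex_subfield F"
    and b: "integral_basis F n b" and b': "integral_basis F n b'"
    and \<sigma>: "bij_betw \<sigma> {1..n} (field_embeddings F)" and \<sigma>': "bij_betw \<sigma>' {1..n} (field_embeddings F)"
  shows "(det (mat n n (\<lambda>(j, i). \<sigma>' (Suc j) (b' (Suc i)))))\<^sup>2 =
    (det (mat n n (\<lambda>(j, i). \<sigma> (Suc j) (b (Suc i)))))\<^sup>2"
proof -
  have "\<exists>c. b' (Suc i) = (\<Sum>k<n. of_int (c k) * b (Suc k))" if "i < n" for i
    by (rule integral_basis_span[OF b, THEN iffD1, OF integral_basis_mem[OF b' that]])
  then obtain C where C: "\<And>i. i < n \<Longrightarrow> b' (Suc i) = (\<Sum>k<n. of_int (C i k) * b (Suc k))"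
    by metis
  have "\<exists>c. b (Suc i) = (\<Sum>k<n. of_int (c k) * b' (Suc k))" if "i < n" for i
    by (rule integral_basis_span[OF b', THEN iffD1, OF integral_basis_mem[OF b that]])
  then obtain C' where C': "\<And>i. i < n \<Longrightarrow> b (Suc i) = (\<Sum>k<n. of_int (C' i k) * b' (Suc k))"
    by metis
  have inverse: "(\<Sum>k<n. C i k * C' k m) = of_bool (i = m)" if i: "i < n" and m: "m < n" for i m
  proof -
    define e where "e m = (\<Sum>k<n. C i k * C' k m) - of_bool (i = m)" for m
    have "b' (Suc i) = (\<Sum>k<n. of_int (C i k) * (\<Sum>m<n. of_int (C' k m) * b' (Suc m)))"
      using C[OF i] C' by simp
    also have "\<dots> = (\<Sum>m<n. of_int (\<Sum>k<n. C i k * C' k m) * b' (Suc m))"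
      unfolding sum_distrib_left by (subst sum.swap) (simp add: sum_distrib_right mult.assoc)
    finally have "(\<Sum>m<n. of_int (\<Sum>k<n. C i k * C' k m) * b' (Suc m)) = b' (Suc i)" by (rule sym)
    moreover have "(\<Sum>m<n. of_int (of_bool (i = m)) * b' (Suc m)) = b' (Suc i)"
      unfolding of_int_of_bool by (rule sum_of_bool_single[OF i, of "\<lambda>m. b' (Suc m)"])
    ultimately have "(\<Sum>m<n. of_int (e m) * b' (Suc m)) = 0"
      unfolding e_def of_int_diff left_diff_distrib sum_subtractf by (simp only: diff_self)
    then have "e m = 0" using integral_basis_indep[OF b' _ m] by blast
    then show ?thesis by (simp add: e_def)
  qed
  have "mat n n (\<lambda>(i, m). \<Sum>k<n. C i k * C' k m) = mat n n (\<lambda>(i, j). of_bool (i = j))"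
    by (rule eq_matI) (auto simp: inverse)
  then have "det (mat n n (\<lambda>(i, k). C i k)) * det (mat n n (\<lambda>(i, k). C' i k)) = 1"
    by (simp add: det_identity_entries flip: det_sum_product)
  then have unit: "(det (mat n n (\<lambda>(i, k). C i k)))\<^sup>2 = 1"
    by (auto simp: zmult_eq_1_iff)
  have \<sigma>'_in: "\<sigma>' (Suc j) \<in> field_embeddings F" if "j < n" for j
    using that bij_betw_apply[OF \<sigma>', of "Suc j"] by simp
  have "mat n n (\<lambda>(j, i). \<sigma>' (Suc j) (b' (Suc i))) =
      mat n n (\<lambda>(j, i). \<Sum>k<n. \<sigma>' (Suc j) (b (Suc k)) * of_int (C i k))"
    by (rule eq_matI)
      (auto simp: C embedding_int_combination[OF F \<sigma>'_in] integral_basis_in_field[OF b]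
        intro!: sum.cong mult.commute)
  moreover have "det (mat n n (\<lambda>(k, i). of_int (C i k))) = (of_int (det (mat n n (\<lambda>(i, k). C i k))) :: complex)"
    unfolding det_swap_indices[of n "\<lambda>i k. of_int (C i k)"] of_int_hom.hom_det[symmetric]
    by (rule arg_cong[of _ _ det], rule eq_matI) auto
  ultimately have "(det (mat n n (\<lambda>(j, i). \<sigma>' (Suc j) (b' (Suc i)))))\<^sup>2 =
      (det (mat n n (\<lambda>(j, i). \<sigma>' (Suc j) (b (Suc i)))))\<^sup>2 * of_int ((det (mat n n (\<lambda>(i, k). C i k)))\<^sup>2)"
    by (simp add: det_sum_product power_mult_distrib)
  also have "\<dots> = (det (mat n n (\<lambda>(j, i). \<sigma>' (Suc j) (b (Suc i)))))\<^sup>2"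
    unfolding unit by simp
  also have "\<dots> = (det (mat n n (\<lambda>(j, i). \<sigma> (Suc j) (b (Suc i)))))\<^sup>2"
    using det_embeddings_square[OF F \<sigma>, of b] det_embeddings_square[OF F \<sigma>', of b]
      integral_basis_in_field[OF b] by simp
  finally show ?thesis .
qed

text \<open>
  The square is the determinant of the trace matrix, whose entries are integers: if the conjugates form an
  invertible matrix, the trace of \<open>u\<close> is the sum of the eigenvalues of multiplication by \<open>u\<close>, which is an integer matrix
  in the basis \<open>b\<close>.
\<close>

lemma det_embeddings_square_integer:
  fixes \<sigma> :: "nat \<Rightarrow> complex \<Rightarrow> complex"
  assumes F: "complex_subfield F"
    and mult_closed: "\<And>u v. u \<in> ring_of_integers F \<Longrightarrow> v \<in> ring_of_integers F \<Longrightarrow> u * v \<in> ring_of_integers F"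
    and b: "integral_basis F n b"
    and \<sigma>: "bij_betw \<sigma> {1..n} (field_embeddings F)"
  shows "(det (mat n n (\<lambda>(j, i). \<sigma> (Suc j) (b (Suc i)))))\<^sup>2 \<in> \<int>"
proof (cases "det (mat n n (\<lambda>(j, i). \<sigma> (Suc j) (b (Suc i)))) = 0")
  case False
  have \<sigma>_in: "\<sigma> (Suc j) \<in> field_embeddings F" if "j < n" for j
    using that bij_betw_apply[OF \<sigma>, of "Suc j"] by simp
  have trace: "(\<Sum>\<tau>\<in>field_embeddings F. \<tau> u) \<in> (\<int> :: complex set)" if u: "u \<in> ring_of_integers F" for u
  proof -
    have "\<exists>c. u * b (Suc i) = (\<Sum>k<n. of_int (c k) * b (Suc k))" if "i < n" for i
      by (rule integral_basis_span[OF b, THEN iffD1, OF mult_closed[OF u integral_basis_mem[OF b that]]])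
    then obtain M where M: "\<And>i. i < n \<Longrightarrow> u * b (Suc i) = (\<Sum>k<n. of_int (M i k) * b (Suc k))"
      by metis
    have uF: "u \<in> F" using u by (simp add: ring_of_integers_def)
    have "\<sigma> (Suc j) u * \<sigma> (Suc j) (b (Suc i)) = (\<Sum>k<n. of_int (M i k) * \<sigma> (Suc j) (b (Suc k)))"
      if "j < n" "i < n" for i j
      unfolding embedding_mult[OF F \<sigma>_in[OF that(1)] uF integral_basis_in_field[OF b that(2)], symmetric] M[OF that(2)]
      by (rule embedding_int_combination[OF F \<sigma>_in[OF that(1)] integral_basis_in_field[OF b]])
    then have "(\<Sum>j<n. \<sigma> (Suc j) u) = (\<Sum>i<n. of_int (M i i))"
      by (rule sum_eigenvalues_eq_trace[OF False])
    moreover have "(\<Sum>j<n. \<sigma> (Suc j) u) = (\<Sum>\<tau>\<in>field_embeddings F. \<tau> u)"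
      using sum.reindex_bij_betw[OF \<sigma>, of "\<lambda>\<tau>. \<tau> u"] by (simp add: sum.atLeast1_atMost_eq)
    moreover have "(\<Sum>i<n. of_int (M i i)) \<in> (\<int> :: complex set)"
      by (intro Ints_sum Ints_of_int)
    ultimately show ?thesis by simp
  qed
  interpret Z: unital_subring "\<int> :: complex set"
    by standard auto
  show ?thesis
    by (subst det_embeddings_square[OF F \<sigma>])
      (auto intro!: Z.det trace mult_closed integral_basis_mem[OF b] integral_basis_in_field[OF b])
qed auto

text \<open>
  The discriminant is a definite description over all bases and enumerations; the two preceding lemmas
  give uniqueness and existence. That the integers of \<open>F\<close> are closed under products is taken as a hypothesis,
  which a field inside \<open>K\<close> with \<open>\<int>\<^sub>K = \<int>[\<alpha>]\<close> satisfies for the trivial reason that \<open>\<int>[\<alpha>]\<close> is a ring.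
\<close>

lemma field_discriminant_eq_det_square:
  fixes \<sigma> :: "nat \<Rightarrow> complex \<Rightarrow> complex"
  assumes F: "complex_subfield F"
    and mult_closed: "\<And>u v. u \<in> ring_of_integers F \<Longrightarrow> v \<in> ring_of_integers F \<Longrightarrow> u * v \<in> ring_of_integers F"
    and b: "integral_basis F n b"
    and \<sigma>: "bij_betw \<sigma> {1..n} (field_embeddings F)"
  shows "of_int (field_discriminant F) = (det (mat n n (\<lambda>(j, i). \<sigma> (Suc j) (b (Suc i)))))\<^sup>2"
proof -
  obtain D where D: "(det (mat n n (\<lambda>(j, i). \<sigma> (Suc j) (b (Suc i)))))\<^sup>2 = of_int D"
    using det_embeddings_square_integer[OF assms] by (auto elim: Ints_cases)
  have "field_discriminant F = D"
    unfolding field_discriminant_def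
  proof (rule the_equality)
    show "\<exists>m b \<sigma>. integral_basis F m b \<and>
       bij_betw \<sigma> {1..m} (field_embeddings F :: (complex \<Rightarrow> complex) set) \<and>
       of_int D = (det (mat m m (\<lambda>(i, j). \<sigma> (Suc i) (b (Suc j)))))\<^sup>2"
      by (intro exI conjI) (rule b, rule \<sigma>, rule D[symmetric])
  next
    fix D'
    assume "\<exists>m b \<sigma>. integral_basis F m b \<and>
       bij_betw \<sigma> {1..m} (field_embeddings F :: (complex \<Rightarrow> complex) set) \<and>
       of_int D' = (det (mat m m (\<lambda>(i, j). \<sigma> (Suc i) (b (Suc j)))))\<^sup>2"
    then obtain m b' \<sigma>' where *: "integral_basis F m b'"
      "bij_betw \<sigma>' {1..m} (field_embeddings F :: (complex \<Rightarrow> complex) set)"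
      "of_int D' = (det (mat m m (\<lambda>(i, j). \<sigma>' (Suc i) (b' (Suc j)))))\<^sup>2"
      by blast
    have "m = n"
      using bij_betw_same_card[OF *(2)] bij_betw_same_card[OF \<sigma>] by simp
    have "(of_int D' :: complex) = of_int D"
      unfolding D[symmetric] *(3) \<open>m = n\<close>
      by (rule det_embeddings_square_basis_independent[OF F b _ \<sigma>])
        (use * \<open>m = n\<close> in simp_all)
    then show "D' = D" by simp
  qed
  then show ?thesis using D by simp
qed

section \<open>Totally real fields\<close>

lemma complex_subfield_poly:
  assumes F: "complex_subfield F" and x: "x \<in> F"
  shows "poly (map_poly of_int p) x \<in> F"
proof (induction p)
  case 0
  show ?case using F by (simp add: complex_subfield_def)
next
  case (pCons a p)
  then show ?case
    using F x complex_subfield_of_int[OF F, of a] by (simp add: map_poly_pCons complex_subfield_def)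
qed

lemma embedding_poly:
  fixes \<tau> :: "complex \<Rightarrow> 'a :: field_char_0"
  assumes F: "complex_subfield F" and \<tau>: "\<tau> \<in> field_embeddings F" and x: "x \<in> F"
  shows "\<tau> (poly (map_poly of_int p) x) = poly (map_poly of_int p) (\<tau> x)"
proof (induction p)
  case 0
  show ?case by (simp add: embedding_zero[OF F \<tau>])
next
  case (pCons a p)
  have "x * poly (map_poly of_int p) x \<in> F"
    using F x complex_subfield_poly[OF F x] by (simp add: complex_subfield_def)
  then show ?case
    using pCons x complex_subfield_poly[OF F x] complex_subfield_of_int[OF F, of a]
    by (simp add: map_poly_pCons embedding_add[OF F \<tau>] embedding_mult[OF F \<tau>] embedding_of_int[OF F \<tau>])
qed

text \<open>
  The elements with real image form a subfield, so reality may be checked on generators.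
\<close>

lemma embedding_real_on_generated_field:
  fixes \<tau> :: "complex \<Rightarrow> complex"
  assumes \<tau>: "\<tau> \<in> field_embeddings (generated_field S)" and S: "\<And>s. s \<in> S \<Longrightarrow> \<tau> s \<in> \<real>"
    and x: "x \<in> generated_field S"
  shows "\<tau> x \<in> \<real>"
proof -
  let ?F = "generated_field S"
  have F: "complex_subfield ?F" by (rule complex_subfield_generated_field)
  note emb = embedding_zero[OF F \<tau>] embedding_one[OF F \<tau>] embedding_add[OF F \<tau>]
    embedding_mult[OF F \<tau>] embedding_minus[OF F \<tau>]
  have inv: "\<tau> (inverse y) \<in> \<real>" if y: "y \<in> ?F" "\<tau> y \<in> \<real>" for y
  proof (cases "y = 0")
    case False
    have "inverse y \<in> ?F" using F y by (simp add: complex_subfield_def)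
    then have "\<tau> y * \<tau> (inverse y) = 1"
      using emb(4)[of y "inverse y"] y False emb(2) by simp
    then have "\<tau> (inverse y) = inverse (\<tau> y)" by (metis inverse_unique)
    then show ?thesis using y by simp
  qed (simp add: emb)
  have "complex_subfield {y \<in> ?F. \<tau> y \<in> \<real>}"
    using F inv by (auto simp: complex_subfield_def emb)
  then have "?F \<subseteq> {y \<in> ?F. \<tau> y \<in> \<real>}"
    by (rule generated_field_minimal) (use generated_field_superset S in blast)
  then show ?thesis using x by blast
qed

lemma bij_betw_real_complex_embeddings:
  assumes F: "complex_subfield F"
    and real: "\<And>\<tau> x. \<tau> \<in> (field_embeddings F :: (complex \<Rightarrow> complex) set) \<Longrightarrow> x \<in> F \<Longrightarrow> \<tau> x \<in> \<real>"
  shows "bij_betw (\<lambda>\<sigma>. restrict (\<lambda>x. complex_of_real (\<sigma> x)) F) (field_embeddings F) (field_embeddings F)"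
proof (rule bij_betw_byWitness[where f' = "\<lambda>\<tau>. restrict (\<lambda>x. Re (\<tau> x)) F"])
  show "\<forall>\<sigma>\<in>field_embeddings F. restrict (\<lambda>x. Re (restrict (\<lambda>x. complex_of_real (\<sigma> x)) F x)) F = \<sigma>"
    by (auto simp: field_embeddings_def fun_eq_iff restrict_def extensional_def)
  show "\<forall>\<tau>\<in>field_embeddings F. restrict (\<lambda>x. complex_of_real (restrict (\<lambda>x. Re (\<tau> x)) F x)) F = \<tau>"
  proof
    fix \<tau> :: "complex \<Rightarrow> complex" assume \<tau>: "\<tau> \<in> field_embeddings F"
    have "\<tau> x = undefined" if "x \<notin> F" for x
      using \<tau> that by (auto simp: field_embeddings_def extensional_def)
    then show "restrict (\<lambda>x. complex_of_real (restrict (\<lambda>x. Re (\<tau> x)) F x)) F = \<tau>"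
      using real[OF \<tau>] by (auto simp: fun_eq_iff restrict_def)
  qed
  have closed: "1 \<in> F" "\<And>x y. x \<in> F \<Longrightarrow> y \<in> F \<Longrightarrow> x + y \<in> F"
    "\<And>x y. x \<in> F \<Longrightarrow> y \<in> F \<Longrightarrow> x * y \<in> F"
    using F by (auto simp: complex_subfield_def)
  show "(\<lambda>\<sigma>. restrict (\<lambda>x. complex_of_real (\<sigma> x)) F) ` field_embeddings F \<subseteq> field_embeddings F"
    using closed by (auto simp: field_embeddings_def)
  show "(\<lambda>\<tau>. restrict (\<lambda>x. Re (\<tau> x)) F) ` field_embeddings F \<subseteq> field_embeddings F"
  proof
    fix \<rho> assume "\<rho> \<in> (\<lambda>\<tau>. restrict (\<lambda>x. Re (\<tau> x)) F) ` field_embeddings F"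
    then obtain \<tau> :: "complex \<Rightarrow> complex" where \<tau>: "\<tau> \<in> field_embeddings F"
      and \<rho>: "\<rho> = restrict (\<lambda>x. Re (\<tau> x)) F" by blast
    show "\<rho> \<in> field_embeddings F"
      using closed real[OF \<tau>] \<tau> unfolding \<rho> field_embeddings_def
      by (auto simp: complex_is_Real_iff)
  qed
qed

text \<open>
  The discriminant is defined through complex embeddings, the index form through real ones.
\<close>

lemma field_discriminant_totally_real:
  fixes \<sigma> :: "nat \<Rightarrow> complex \<Rightarrow> real"
  assumes F: "complex_subfield F"
    and mult_closed: "\<And>u v. u \<in> ring_of_integers F \<Longrightarrow> v \<in> ring_of_integers F \<Longrightarrow> u * v \<in> ring_of_integers F"
    and real: "\<And>\<tau> x. \<tau> \<in> (field_embeddings F :: (complex \<Rightarrow> complex) set) \<Longrightarrow> x \<in> F \<Longrightarrow> \<tau> x \<in> \<real>"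
    and b: "integral_basis F n b"
    and \<sigma>: "bij_betw \<sigma> {1..n} (field_embeddings F)"
  shows "of_int (field_discriminant F) = (det (mat n n (\<lambda>(j, i). \<sigma> (Suc j) (b (Suc i)))))\<^sup>2"
proof -
  interpret h: comm_ring_hom complex_of_real
    by standard auto
  define \<sigma>' where "\<sigma>' j = restrict (\<lambda>x. complex_of_real (\<sigma> j x)) F" for j
  have "bij_betw (\<lambda>\<sigma>. restrict (\<lambda>x. complex_of_real (\<sigma> x)) F) (field_embeddings F) (field_embeddings F)"
    by (rule bij_betw_real_complex_embeddings[OF F]) (rule real)
  moreover have "\<sigma>' = (\<lambda>\<sigma>. restrict (\<lambda>x. complex_of_real (\<sigma> x)) F) \<circ> \<sigma>"
    by (simp add: \<sigma>'_def fun_eq_iff)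
  ultimately have "bij_betw \<sigma>' {1..n} (field_embeddings F)"
    using bij_betw_trans[OF \<sigma>] by (simp only:)
  from field_discriminant_eq_det_square[OF F mult_closed b this]
  have "of_int (field_discriminant F) = (det (mat n n (\<lambda>(j, i). \<sigma>' (Suc j) (b (Suc i)))))\<^sup>2" .
  also have "mat n n (\<lambda>(j, i). \<sigma>' (Suc j) (b (Suc i))) =
      map_mat complex_of_real (mat n n (\<lambda>(j, i). \<sigma> (Suc j) (b (Suc i))))"
    by (rule eq_matI) (auto simp: \<sigma>'_def integral_basis_in_field[OF b])
  finally have "complex_of_real (of_int (field_discriminant F)) =
      complex_of_real ((det (mat n n (\<lambda>(j, i). \<sigma> (Suc j) (b (Suc i)))))\<^sup>2)"
    by simp
  then show ?thesis by (simp only: of_real_eq_iff)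
qed

section \<open>Imaginary quadratic orders\<close>

definition quadratic_order :: "complex \<Rightarrow> complex set" where
  "quadratic_order \<omega> = {of_int a + of_int b * \<omega> | a b. True}"

lemma quadratic_order_mem: "of_int a + of_int b * \<omega> \<in> quadratic_order \<omega>"
  by (auto simp: quadratic_order_def)

lemma unital_subring_quadratic_order:
  assumes t: "\<omega> + cnj \<omega> = of_int t" and N: "\<omega> * cnj \<omega> = of_int N"
  shows "unital_subring (quadratic_order \<omega>)"
proof
  have "\<omega> * \<omega> = (\<omega> + cnj \<omega>) * \<omega> - \<omega> * cnj \<omega>" by (simp add: algebra_simps)
  then have sq: "\<omega> * \<omega> = of_int t * \<omega> - of_int N"
    unfolding t N .
  show "1 \<in> quadratic_order \<omega>"
    using quadratic_order_mem[of 1 0 \<omega>] by simp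
  fix x y assume "x \<in> quadratic_order \<omega>" "y \<in> quadratic_order \<omega>"
  then obtain a b c e where xy: "x = of_int a + of_int b * \<omega>" "y = of_int c + of_int e * \<omega>"
    by (auto simp: quadratic_order_def)
  have "x - y = of_int (a - c) + of_int (b - e) * \<omega>"
    by (simp add: xy algebra_simps)
  then show "x - y \<in> quadratic_order \<omega>" by (simp only: quadratic_order_mem)
  have "x * y = of_int a * of_int c + (of_int a * of_int e + of_int b * of_int c) * \<omega>
      + of_int b * of_int e * (\<omega> * \<omega>)"
    by (simp add: xy algebra_simps)
  also have "\<dots> = of_int (a * c - b * e * N) + of_int (a * e + b * c + b * e * t) * \<omega>"
    unfolding sq by (simp add: algebra_simps)
  finally show "x * y \<in> quadratic_order \<omega>" by (simp only: quadratic_order_mem)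
qed

text \<open>
  The squared absolute value is the norm form \<open>a\<^sup>2 + t a b + N b\<^sup>2\<close>.
\<close>

lemma quadratic_order_norm_integer:
  assumes t: "\<omega> + cnj \<omega> = of_int t" and N: "\<omega> * cnj \<omega> = of_int N"
    and z: "z \<in> quadratic_order \<omega>"
  shows "(cmod z)\<^sup>2 \<in> \<int>"
proof -
  obtain a b where z: "z = of_int a + of_int b * \<omega>"
    using z by (auto simp: quadratic_order_def)
  have "complex_of_real ((cmod z)\<^sup>2) = z * cnj z"
    by (rule complex_norm_square)
  also have "\<dots> = of_int a * of_int a + of_int a * of_int b * (\<omega> + cnj \<omega>) + of_int b * of_int b * (\<omega> * cnj \<omega>)"
    by (simp add: z algebra_simps)
  also have "\<dots> = complex_of_real (of_int (a * a + a * b * t + b * b * N))"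
    unfolding t N by simp
  finally have "(cmod z)\<^sup>2 = of_int (a * a + a * b * t + b * b * N)"
    by (simp only: of_real_eq_iff)
  then show ?thesis by (simp only: Ints_of_int)
qed

text \<open>
  The squared absolute values of two mutually inverse elements are nonnegative integers with product 1.
\<close>

lemma quadratic_order_unit_cmod:
  assumes t: "\<omega> + cnj \<omega> = of_int t" and N: "\<omega> * cnj \<omega> = of_int N"
    and u: "u \<in> quadratic_order \<omega>" and v: "v \<in> quadratic_order \<omega>" and uv: "u * v = 1"
  shows "cmod v = 1"
proof -
  obtain p q :: int where pq: "(cmod u)\<^sup>2 = of_int p" "(cmod v)\<^sup>2 = of_int q"
    using quadratic_order_norm_integer[OF t N u] quadratic_order_norm_integer[OF t N v]
    by (auto elim!: Ints_cases)
  have "(cmod u)\<^sup>2 * (cmod v)\<^sup>2 = 1"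
    unfolding power_mult_distrib[symmetric] norm_mult[symmetric] uv by simp
  then have "of_int (p * q) = (1 :: real)" by (simp add: pq)
  then have "p * q = 1" by (simp only: of_int_eq_1_iff)
  moreover have "0 \<le> q" using pq(2) by (metis of_int_0_le_iff zero_le_power2)
  ultimately have "q = 1" by (auto simp: zmult_eq_1_iff)
  then show ?thesis using pq(2) norm_ge_zero[of v] by (auto simp: power2_eq_1_iff)
qed

section \<open>The relative index of a power integral basis\<close>

text \<open>
  The key identity. Here \<open>a j\<close> is the conjugate of \<open>\<alpha> = \<Sum> z\<^sub>i b\<^sub>i\<close> obtained from the \<open>j\<close>-th real embedding of
  \<open>F\<close> while \<open>\<omega>\<close> stays fixed. As \<open>F\<close> is real and \<open>\<omega>\<close> is not, the integral basis of \<open>F\<close> remains independent over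
  the order \<open>\<int>[\<omega>]\<close>, and the powers of \<open>\<alpha>\<close> have unimodular coordinates \<open>E\<close> with respect to it. Since
  \<open>(a\<^sub>j\<^sup>m) = (\<sigma>\<^sub>j b\<^sub>i) E\<^sup>T\<close> and units of an imaginary quadratic order have absolute value 1, the Vandermonde
  product of the \<open>a\<^sub>j\<close> and the determinant of the conjugates of \<open>b\<close> have the same absolute value.
\<close>

lemma prod_conjugate_differences:
  fixes \<sigma> :: "nat \<Rightarrow> complex \<Rightarrow> real"
  assumes F: "complex_subfield F" and F_real: "F \<subseteq> \<real>"
    and mult_closed: "\<And>u v. u \<in> ring_of_integers F \<Longrightarrow> v \<in> ring_of_integers F \<Longrightarrow> u * v \<in> ring_of_integers F"
    and n: "0 < n" and b: "integral_basis F n b" and b1: "b 1 = 1"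
    and \<sigma>: "bij_betw \<sigma> {1..n} (field_embeddings F)"
    and t: "\<omega> + cnj \<omega> = of_int t" and N: "\<omega> * cnj \<omega> = of_int N" and im: "Im \<omega> \<noteq> 0"
    and z: "\<And>i. z i \<in> quadratic_order \<omega>"
    and gen: "\<And>i. i < n \<Longrightarrow> b (Suc i) \<in> int_adjoin (\<Sum>i<n. z i * b (Suc i))"
  defines "a \<equiv> \<lambda>j. \<Sum>i<n. z i * complex_of_real (\<sigma> (Suc j) (b (Suc i)))"
  shows "(\<Prod>k<n. \<Prod>i<k. cmod (a k - a i)) = \<bar>det (mat n n (\<lambda>(j, i). \<sigma> (Suc j) (b (Suc i))))\<bar>"
proof -
  interpret h: comm_ring_hom complex_of_real
    by standard auto
  have R: "unital_subring (quadratic_order \<omega>)"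
    by (rule unital_subring_quadratic_order[OF t N])
  interpret O: unital_subring "quadratic_order \<omega>" by (rule R)
  note bF = integral_basis_in_field[OF b]
  have \<sigma>_in: "\<sigma> (Suc j) \<in> field_embeddings F" if "j < n" for j
    using that bij_betw_apply[OF \<sigma>, of "Suc j"] by simp
  have "\<exists>c. b (Suc i) * b (Suc k) = (\<Sum>m<n. of_int (c m) * b (Suc m))" if "i < n" "k < n" for i k
    by (rule integral_basis_span[OF b, THEN iffD1,
          OF mult_closed[OF integral_basis_mem[OF b that(1)] integral_basis_mem[OF b that(2)]]])
  then have "\<forall>i k. \<exists>c. i < n \<longrightarrow> k < n \<longrightarrow> b (Suc i) * b (Suc k) = (\<Sum>m<n. of_int (c m) * b (Suc m))"
    by blast
  then obtain c where c: "\<And>i k. i < n \<Longrightarrow> k < n \<Longrightarrow>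
      b (Suc i) * b (Suc k) = (\<Sum>m<n. of_int (c i k m) * b (Suc m))"
    by metis
  have indep: "\<forall>i<n. e i = 0"
    if e: "\<And>i. e i \<in> quadratic_order \<omega>" and sum0: "(\<Sum>i<n. e i * b (Suc i)) = 0" for e
  proof -
    have "\<forall>i. \<exists>p q. e i = of_int p + of_int q * \<omega>"
      using e by (simp add: quadratic_order_def)
    then obtain p q where pq: "\<And>i. e i = of_int (p i) + of_int (q i) * \<omega>" by metis
    define P Q where "P = (\<Sum>i<n. of_int (p i) * b (Suc i))" and "Q = (\<Sum>i<n. of_int (q i) * b (Suc i))"
    have "P \<in> \<real>" "Q \<in> \<real>"
      unfolding P_def Q_def by (intro sum_in_Reals Reals_mult Reals_of_int; use F_real bF in auto)+
    moreover have "(\<Sum>i<n. e i * b (Suc i)) = P + \<omega> * Q"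
      unfolding P_def Q_def pq sum_distrib_left sum.distrib[symmetric]
      by (intro sum.cong) (auto simp: algebra_simps)
    then have "P + \<omega> * Q = 0" using sum0 by simp
    ultimately have "Q = 0" "P = 0"
      using im by (auto simp: complex_eq_iff complex_is_Real_iff)
    then have "p i = 0 \<and> q i = 0" if "i < n" for i
      using integral_basis_indep[OF b _ that] unfolding P_def Q_def by blast
    then show ?thesis by (simp add: pq)
  qed
  have gen': "\<exists>p. (\<forall>m. coeff p m \<in> quadratic_order \<omega>) \<and> b (Suc i) = poly p (\<Sum>i<n. z i * b (Suc i))"
    if i: "i < n" for i
  proof -
    obtain p where "b (Suc i) = poly (map_poly of_int p) (\<Sum>i<n. z i * b (Suc i))"
      using gen[OF i] by (auto simp: int_adjoin_def)
    then show ?thesis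
      by (intro exI[of _ "map_poly of_int p"]) (simp add: coeff_map_poly O.of_int)
  qed
  obtain E u where E: "\<And>s m. s 0 = 1 \<Longrightarrow>
       (\<And>i k. i < n \<Longrightarrow> k < n \<Longrightarrow> s i * s k = (\<Sum>m<n. of_int (c i k m) * s m)) \<Longrightarrow>
       (\<Sum>i<n. z i * s i) ^ m = (\<Sum>i<n. E m i * s i)"
    and u: "u \<in> quadratic_order \<omega>" "det (mat n n (\<lambda>(m, i). E m i)) \<in> quadratic_order \<omega>"
      "u * det (mat n n (\<lambda>(m, i). E m i)) = 1"
    by (rule power_coordinates_unimodular[OF R n, where b = "\<lambda>i. b (Suc i)" and z = z
          and c = "\<lambda>i k m. of_int (c i k m)"])
      (use c b1 indep z gen' O.of_int in auto)
  have pow: "a j ^ m = (\<Sum>i<n. complex_of_real (\<sigma> (Suc j) (b (Suc i))) * E m i)" if j: "j < n" for j m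
  proof -
    let ?s = "\<lambda>i. complex_of_real (\<sigma> (Suc j) (b (Suc i)))"
    have "?s i * ?s k = (\<Sum>m<n. of_int (c i k m) * ?s m)" if ik: "i < n" "k < n" for i k
    proof -
      have "\<sigma> (Suc j) (b (Suc i)) * \<sigma> (Suc j) (b (Suc k)) = (\<Sum>m<n. of_int (c i k m) * \<sigma> (Suc j) (b (Suc m)))"
        unfolding embedding_mult[OF F \<sigma>_in[OF j] bF[OF ik(1)] bF[OF ik(2)], symmetric] c[OF ik]
        by (rule embedding_int_combination[OF F \<sigma>_in[OF j] bF])
      then have "complex_of_real (\<sigma> (Suc j) (b (Suc i)) * \<sigma> (Suc j) (b (Suc k))) =
          complex_of_real (\<Sum>m<n. of_int (c i k m) * \<sigma> (Suc j) (b (Suc m)))"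
        by (rule arg_cong)
      then show ?thesis by simp
    qed
    moreover have "?s 0 = 1"
      using b1 embedding_one[OF F \<sigma>_in[OF j]] by simp
    ultimately have "a j ^ m = (\<Sum>i<n. E m i * ?s i)"
      unfolding a_def by (intro E) auto
    then show ?thesis by (simp add: mult.commute)
  qed
  have "mat n n (\<lambda>(j, m). a j ^ m) =
      mat n n (\<lambda>(j, m). \<Sum>i<n. complex_of_real (\<sigma> (Suc j) (b (Suc i))) * E m i)"
    by (rule eq_matI) (auto simp: pow)
  then have "(\<Prod>k<n. \<Prod>i<k. a k - a i) =
      det (mat n n (\<lambda>(j, i). complex_of_real (\<sigma> (Suc j) (b (Suc i))))) * det (mat n n (\<lambda>(i, m). E m i))"
    unfolding det_vandermonde[symmetric] by (simp only: det_sum_product)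
  also have "mat n n (\<lambda>(j, i). complex_of_real (\<sigma> (Suc j) (b (Suc i)))) =
      map_mat complex_of_real (mat n n (\<lambda>(j, i). \<sigma> (Suc j) (b (Suc i))))"
    by (rule eq_matI) auto
  also have "det (mat n n (\<lambda>(i, m). E m i)) = det (mat n n (\<lambda>(m, i). E m i))"
    by (rule det_swap_indices)
  finally have "cmod (\<Prod>k<n. \<Prod>i<k. a k - a i) = \<bar>det (mat n n (\<lambda>(j, i). \<sigma> (Suc j) (b (Suc i))))\<bar>"
    using quadratic_order_unit_cmod[OF t N u] by (simp add: norm_mult)
  then show ?thesis by (simp add: prod_norm)
qed

section \<open>Bounds for the index form\<close>

lemma prod_pairs_reindex:
  fixes g :: "nat \<Rightarrow> nat \<Rightarrow> 'a :: comm_monoid_mult"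
  shows "(\<Prod>j=1..n. \<Prod>k\<in>{j<..n}. g j k) = (\<Prod>k<n. \<Prod>i<k. g (Suc i) (Suc k))"
proof -
  have "(\<Prod>j=1..n. \<Prod>k\<in>{j<..n}. g j k) = (\<Prod>(j, k)\<in>(SIGMA j:{1..n}. {j<..n}). g j k)"
    by (simp add: prod.Sigma)
  also have "\<dots> = (\<Prod>(k, i)\<in>(SIGMA k:{..<n}. {..<k}). g (Suc i) (Suc k))"
    by (rule prod.reindex_bij_witness[where i = "\<lambda>(k, i). (Suc i, Suc k)" and j = "\<lambda>(j, k). (k - 1, j - 1)"])
      auto
  finally show ?thesis by (simp add: prod.Sigma)
qed

text \<open>
  There are \<open>n (n - 1) / 2\<close> pairs, each contributing a factor \<open>C\<close>.
\<close>

lemma prod_pairs_le: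
  fixes g h :: "nat \<Rightarrow> nat \<Rightarrow> real"
  assumes "\<And>i k. i < k \<Longrightarrow> k < n \<Longrightarrow> 0 \<le> g i k \<and> g i k \<le> C * h i k"
  shows "(\<Prod>k<n. \<Prod>i<k. g i k) \<le> C ^ (n * (n - 1) div 2) * (\<Prod>k<n. \<Prod>i<k. h i k)"
proof -
  have "(\<Prod>k<n. \<Prod>i<k. g i k) \<le> (\<Prod>k<n. \<Prod>i<k. C * h i k)"
    using assms by (intro prod_mono conjI prod_nonneg ballI) auto
  also have "\<dots> = (\<Prod>k<n. C ^ k) * (\<Prod>k<n. \<Prod>i<k. h i k)"
    by (simp add: prod.distrib)
  also have "(\<Prod>k<n. C ^ k) = C ^ (\<Sum>k<n. k)"
    by (simp add: power_sum)
  also have "(\<Sum>k<n. k) = n * (n - 1) div 2"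
    using Sum_Ico_nat[of 0 n] by (simp add: atLeast0LessThan)
  finally show ?thesis .
qed


text \<open>
  A factorwise comparison with a product known to equal \<open>\<bar>w\<bar> = \<surd>\<bar>D\<bar>\<close>. In the degenerate
  case \<open>w = 0\<close> the convention \<open>1 / 0 = 0\<close> makes the index form vanish.
\<close>

lemma index_form_bound:
  fixes \<sigma> :: "nat \<Rightarrow> complex \<Rightarrow> real" and v :: "nat \<Rightarrow> int"
  assumes n: "0 < n" and b1: "b 1 = 1"
    and \<sigma>1: "\<And>j. j \<in> {1..n} \<Longrightarrow> \<sigma> j 1 = 1"
    and disc: "of_int (field_discriminant F) = w\<^sup>2"
    and h: "(\<Prod>k<n. \<Prod>i<k. h i k) = \<bar>w\<bar>" and C: "0 \<le> C"
    and le: "\<And>i k. i < k \<Longrightarrow> k < n \<Longrightarrow>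
      \<bar>\<Sum>m<n. of_int (v (Suc m)) * (\<sigma> (Suc i) (b (Suc m)) - \<sigma> (Suc k) (b (Suc m)))\<bar> \<le> C * h i k"
  shows "\<bar>index_form F n b \<sigma> v\<bar> \<le> C ^ (n * (n - 1) div 2)"
proof -
  define P where "P = (\<Prod>k<n. \<Prod>i<k.
      \<bar>\<Sum>m<n. of_int (v (Suc m)) * (\<sigma> (Suc i) (b (Suc m)) - \<sigma> (Suc k) (b (Suc m)))\<bar>)"
  have root: "sqrt (of_int \<bar>field_discriminant F\<bar>) = \<bar>w\<bar>"
  proof -
    have "of_int \<bar>field_discriminant F\<bar> = w\<^sup>2" using disc by simp
    then show ?thesis by simp
  qed
  (* The term of the basis element 1 is zero, so the sum may start there as well. *)
  have "(\<Sum>i=2..n. of_int (v i) * (\<sigma> j (b i) - \<sigma> k (b i))) =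
      (\<Sum>m<n. of_int (v (Suc m)) * (\<sigma> j (b (Suc m)) - \<sigma> k (b (Suc m))))"
    if "j \<in> {1..n}" "k \<in> {1..n}" for j k
  proof -
    have "{1..n} = insert 1 {2..n}" using n by auto
    then have "(\<Sum>i=1..n. of_int (v i) * (\<sigma> j (b i) - \<sigma> k (b i))) =
        (\<Sum>i=2..n. of_int (v i) * (\<sigma> j (b i) - \<sigma> k (b i)))"
      using b1 \<sigma>1 that by simp
    then show ?thesis by (simp add: sum.atLeast1_atMost_eq)
  qed
  then have "index_form F n b \<sigma> v = 1 / sqrt (of_int \<bar>field_discriminant F\<bar>) *
      (\<Prod>j=1..n. \<Prod>k\<in>{j<..n}. \<Sum>m<n. of_int (v (Suc m)) * (\<sigma> j (b (Suc m)) - \<sigma> k (b (Suc m))))"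
    unfolding index_form_def by (intro arg_cong2[of _ _ _ _ "(*)"] prod.cong refl) auto
  then have index: "\<bar>index_form F n b \<sigma> v\<bar> = P / \<bar>w\<bar>"
    unfolding prod_pairs_reindex root P_def by (simp add: abs_mult abs_prod)
  show ?thesis
  proof (cases "w = 0")
    case False
    have "P \<le> C ^ (n * (n - 1) div 2) * (\<Prod>k<n. \<Prod>i<k. h i k)"
      unfolding P_def using le by (intro prod_pairs_le) auto
    then show ?thesis using False unfolding index h by (simp add: divide_le_eq)
  qed (use index C in simp)
qed

lemma imag_sqrt_simps:
  assumes "0 \<le> d"
  shows "Re (imag_sqrt d) = 0" "Im (imag_sqrt d) = sqrt (of_int d)" "cnj (imag_sqrt d) = - imag_sqrt d"
    "imag_sqrt d * imag_sqrt d = - of_int d"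
  using assms by (simp_all add: imag_sqrt_def complex_eq_iff)

text \<open>
  Trace and norm of \<open>\<omega>\<close> are \<open>1, (1 + d) / 4\<close> when \<open>-d \<equiv> 1\<close> modulo 4, and \<open>0, d\<close> otherwise.
\<close>

lemma quadratic_omega_integral:
  assumes d: "0 \<le> d"
  obtains t N :: int where "quadratic_omega d + cnj (quadratic_omega d) = of_int t"
    and "quadratic_omega d * cnj (quadratic_omega d) = of_int N"
proof (cases "[- d = 1] (mod 4)")
  case True
  then have "4 dvd 1 + d"
    using dvd_minus_iff[of 4 "- d - 1"] by (simp add: cong_iff_dvd_diff add.commute)
  then obtain N where N: "1 + d = 4 * N" by (auto elim: dvdE)
  have \<omega>: "quadratic_omega d = (1 + imag_sqrt d) / 2" using True by (simp add: quadratic_omega_def)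
  have "quadratic_omega d + cnj (quadratic_omega d) = of_int 1"
    unfolding \<omega> using d by (simp add: imag_sqrt_simps field_simps)
  moreover have "quadratic_omega d * cnj (quadratic_omega d) = (1 - imag_sqrt d * imag_sqrt d) / 4"
    unfolding \<omega> using d by (simp add: imag_sqrt_simps(3) field_simps)
  then have "quadratic_omega d * cnj (quadratic_omega d) = of_int (1 + d) / 4"
    using d by (simp add: imag_sqrt_simps(4))
  then have "quadratic_omega d * cnj (quadratic_omega d) = of_int N"
    unfolding N by simp
  ultimately show ?thesis by (rule that)
next
  case False
  then have \<omega>: "quadratic_omega d = imag_sqrt d" by (simp add: quadratic_omega_def)
  show ?thesis
    by (rule that[of 0 d]) (use d in \<open>simp_all add: \<omega> imag_sqrt_simps(3,4)\<close>)
qed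

lemma int_adjoin_mult:
  assumes "u \<in> int_adjoin \<alpha>" "v \<in> int_adjoin \<alpha>"
  shows "u * v \<in> int_adjoin \<alpha>"
proof -
  obtain p q where "u = poly (map_poly of_int p) \<alpha>" "v = poly (map_poly of_int q) \<alpha>"
    using assms by (auto simp: int_adjoin_def)
  then have "u * v = poly (map_poly of_int (p * q)) \<alpha>"
    by (simp add: hom_distribs)
  then show ?thesis by (auto simp: int_adjoin_def)
qed

lemma degree_pos_of_monic_irreducible:
  fixes f :: "int poly"
  assumes "irreducible f" and "lead_coeff f = 1"
  shows "0 < degree f"
proof (rule ccontr)
  assume "\<not> 0 < degree f"
  then have "f = 1"
    using assms(2) by (auto elim!: degree_eq_zeroE simp: one_pCons)
  then show False using assms(1) by (simp add: irreducible_def)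
qed

theorem theorem2:
  fixes f :: "int poly" and \<xi> \<omega> \<alpha> :: complex and n :: nat and d :: int
    and L M K :: "complex set" and l :: "nat \<Rightarrow> complex"
    and \<sigma> :: "nat \<Rightarrow> complex \<Rightarrow> real" and x y :: "nat \<Rightarrow> int"
  assumes "irreducible f" and "lead_coeff f = 1" and "degree f = n"
    and "\<forall>z :: complex. poly (map_poly of_int f) z = 0 \<longrightarrow> z \<in> \<real>"
    and "poly (map_poly of_int f) \<xi> = 0"
    and "L = generated_field {\<xi>}"
    and "integral_basis L n l" and "l 1 = 1"
    and "bij_betw \<sigma> {1..n} (field_embeddings L)"
    and "d > 0" and "squarefree d"
    and "M = generated_field {imag_sqrt d}"
    and "gcd (field_discriminant L) (field_discriminant M) = 1"
    and "\<omega> = quadratic_omega d"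
    and "K = generated_field (L \<union> M)"
    and "\<alpha> = of_int (x 1) + (\<Sum>i=2..n. of_int (x i) * l i)
             + of_int (y 1) * \<omega> + (\<Sum>i=2..n. of_int (y i) * \<omega> * l i)"
    and "generates_power_integral_basis K \<alpha>"
  shows "([- d = 2] (mod 4) \<or> [- d = 3] (mod 4) \<longrightarrow>
            \<bar>index_form L n l \<sigma> x\<bar> \<le> 1 \<and>
            \<bar>index_form L n l \<sigma> y\<bar> \<le> 1 / sqrt (of_int d) ^ (n * (n - 1) div 2)) \<and>
         ([- d = 1] (mod 4) \<longrightarrow>
            \<bar>index_form L n l \<sigma> (\<lambda>i. 2 * x i + y i)\<bar> \<le> 2 ^ (n * (n - 1) div 2) \<and>
            \<bar>index_form L n l \<sigma> y\<bar> \<le> (2 / sqrt (of_int d)) ^ (n * (n - 1) div 2))"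
proof -
  have n: "0 < n"
    using degree_pos_of_monic_irreducible[OF assms(1,2)] assms(3) by simp
  have L: "complex_subfield L"
    unfolding assms(6) by (rule complex_subfield_generated_field)
  have "\<xi> \<in> L"
    unfolding assms(6) using generated_field_superset by blast
  have "L \<subseteq> \<real>"
    unfolding assms(6) using assms(4,5)
    by (intro generated_field_minimal complex_subfield_Reals) auto
  have embeddings_real: "\<tau> u \<in> \<real>"
    if \<tau>: "\<tau> \<in> (field_embeddings L :: (complex \<Rightarrow> complex) set)" and u: "u \<in> L" for \<tau> u
  proof (rule embedding_real_on_generated_field[of \<tau> "{\<xi>}"])
    have "poly (map_poly of_int f) (\<tau> \<xi>) = 0"
      using embedding_poly[OF L \<tau> \<open>\<xi> \<in> L\<close>, of f] assms(5) embedding_zero[OF L \<tau>] by simp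
    then show "\<tau> s \<in> \<real>" if "s \<in> {\<xi>}" for s using that assms(4) by blast
  qed (use \<tau> u assms(6) in auto)
  have "L \<subseteq> K"
    unfolding assms(15) using generated_field_superset by blast
  have Z_K: "ring_of_integers K = int_adjoin \<alpha>"
    using assms(17) by (simp add: generates_power_integral_basis_def)
  (* This is how the power integral basis enters: every integer of L is an integer polynomial in \<alpha>. *)
  have Z_L: "ring_of_integers L = int_adjoin \<alpha> \<inter> L"
    using Z_K \<open>L \<subseteq> K\<close> by (auto simp: ring_of_integers_def)
  have mult_closed: "u * v \<in> ring_of_integers L"
    if "u \<in> ring_of_integers L" "v \<in> ring_of_integers L" for u v
    using that L int_adjoin_mult by (auto simp: Z_L complex_subfield_def)
  define z where "z i = of_int (x (Suc i)) + of_int (y (Suc i)) * \<omega>" for i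
  have \<alpha>: "\<alpha> = (\<Sum>i<n. z i * l (Suc i))"
  proof -
    have "(\<Sum>i<n. z i * l (Suc i)) = (\<Sum>i=1..n. (of_int (x i) + of_int (y i) * \<omega>) * l i)"
      by (simp add: z_def sum.atLeast1_atMost_eq)
    also have "{1..n} = insert 1 {2..n}" using n by auto
    finally show ?thesis
      using assms(8) by (simp add: assms(16) distrib_right sum.distrib)
  qed
  have d: "0 \<le> d" "0 < sqrt (of_int d)" using assms(10) by auto
  obtain t N where tN: "\<omega> + cnj \<omega> = of_int t" "\<omega> * cnj \<omega> = of_int N"
    using quadratic_omega_integral[OF d(1)] unfolding assms(14) by blast
  have im: "Im \<omega> \<noteq> 0"
    using d by (simp add: assms(14) quadratic_omega_def imag_sqrt_simps)
  define w where "w = det (mat n n (\<lambda>(j, i). \<sigma> (Suc j) (l (Suc i))))"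
  define a where "a j = (\<Sum>i<n. z i * complex_of_real (\<sigma> (Suc j) (l (Suc i))))" for j
  have disc: "of_int (field_discriminant L) = w\<^sup>2"
    unfolding w_def
    by (rule field_discriminant_totally_real[OF L]) (use mult_closed embeddings_real assms in auto)
  have prod_a: "(\<Prod>k<n. \<Prod>i<k. cmod (a k - a i)) = \<bar>w\<bar>"
    unfolding w_def a_def
  proof (rule prod_conjugate_differences[OF L \<open>L \<subseteq> \<real>\<close> mult_closed n assms(7-9) tN im])
    show "z i \<in> quadratic_order \<omega>" for i
      unfolding z_def by (rule quadratic_order_mem)
    show "l (Suc i) \<in> int_adjoin (\<Sum>i<n. z i * l (Suc i))" if "i < n" for i
      using integral_basis_mem[OF assms(7) that] unfolding Z_L \<alpha>[symmetric] by blast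
  qed
  have \<sigma>1: "\<sigma> j 1 = 1" if "j \<in> {1..n}" for j
    using embedding_one[OF L bij_betw_apply[OF assms(9) that]] .
  define D where "D v i k = (\<Sum>m<n. of_int (v (Suc m)) * (\<sigma> (Suc i) (l (Suc m)) - \<sigma> (Suc k) (l (Suc m))))"
    for v :: "nat \<Rightarrow> int" and i k
  have a_diff: "a i - a k = of_real (D x i k) + \<omega> * of_real (D y i k)" for i k
    unfolding a_def D_def z_def of_real_sum sum_distrib_left sum_subtractf[symmetric] sum.distrib[symmetric]
    by (intro sum.cong) (auto simp: algebra_simps)
  have bound: "\<bar>index_form L n l \<sigma> v\<bar> \<le> C ^ (n * (n - 1) div 2)"
    if "0 \<le> C" "\<And>i k. \<bar>D v i k\<bar> \<le> C * cmod (a i - a k)" for v C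
  proof (rule index_form_bound[where w = w and h = "\<lambda>i k. cmod (a k - a i)"])
    show "\<bar>\<Sum>m<n. of_int (v (Suc m)) * (\<sigma> (Suc i) (l (Suc m)) - \<sigma> (Suc k) (l (Suc m)))\<bar>
        \<le> C * cmod (a k - a i)" for i k
      using that(2)[of i k] by (simp add: D_def norm_minus_commute)
  qed (use n assms(8) \<sigma>1 disc prod_a that(1) in auto)
  (* D x and D y are real, so the real and imaginary parts of a i - a k can be read off. *)
  have Re_le: "\<bar>D x i k + Re \<omega> * D y i k\<bar> \<le> cmod (a i - a k)" for i k
    using abs_Re_le_cmod[of "a i - a k"] by (simp add: a_diff)
  have Im_le: "\<bar>Im \<omega>\<bar> * \<bar>D y i k\<bar> \<le> cmod (a i - a k)" for i k
    using abs_Im_le_cmod[of "a i - a k"] by (simp add: a_diff abs_mult)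
  show ?thesis
  proof (intro conjI[of "_ \<longrightarrow> _"] impI)
    assume "[- d = 2] (mod 4) \<or> [- d = 3] (mod 4)"
    then have "\<not> [- d = 1] (mod 4)"
      by (auto simp: cong_def)
    then have \<omega>: "Re \<omega> = 0" "Im \<omega> = sqrt (of_int d)"
      using d by (simp_all add: assms(14) quadratic_omega_def imag_sqrt_simps)
    have "\<bar>index_form L n l \<sigma> x\<bar> \<le> 1 ^ (n * (n - 1) div 2)"
      using Re_le by (intro bound) (simp_all add: \<omega>)
    moreover have "\<bar>index_form L n l \<sigma> y\<bar> \<le> (1 / sqrt (of_int d)) ^ (n * (n - 1) div 2)"
      using Im_le d by (intro bound) (simp_all add: \<omega> field_simps)
    ultimately show "\<bar>index_form L n l \<sigma> x\<bar> \<le> 1 \<and>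
        \<bar>index_form L n l \<sigma> y\<bar> \<le> 1 / sqrt (of_int d) ^ (n * (n - 1) div 2)"
      by (simp add: power_one_over)
  next
    assume "[- d = 1] (mod 4)"
    then have \<omega>: "Re \<omega> = 1 / 2" "Im \<omega> = sqrt (of_int d) / 2"
      using d by (simp_all add: assms(14) quadratic_omega_def imag_sqrt_simps)
    have double: "D (\<lambda>i. 2 * x i + y i) i k = 2 * (D x i k + Re \<omega> * D y i k)" for i k
      unfolding D_def \<omega> sum_distrib_left sum.distrib[symmetric]
      by (intro sum.cong) (auto simp: algebra_simps)
    have "\<bar>D (\<lambda>i. 2 * x i + y i) i k\<bar> \<le> 2 * cmod (a i - a k)" for i k
      using Re_le[of i k] unfolding double abs_mult by simp
    then have "\<bar>index_form L n l \<sigma> (\<lambda>i. 2 * x i + y i)\<bar> \<le> 2 ^ (n * (n - 1) div 2)"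
      by (intro bound) simp_all
    moreover have "\<bar>index_form L n l \<sigma> y\<bar> \<le> (2 / sqrt (of_int d)) ^ (n * (n - 1) div 2)"
      using Im_le d by (intro bound) (simp_all add: \<omega> field_simps)
    ultimately show "\<bar>index_form L n l \<sigma> (\<lambda>i. 2 * x i + y i)\<bar> \<le> 2 ^ (n * (n - 1) div 2) \<and>
        \<bar>index_form L n l \<sigma> y\<bar> \<le> (2 / sqrt (of_int d)) ^ (n * (n - 1) div 2)" ..
  qed
qed

end
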